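(* Let $\omega$ be a symmetric $(p,p)$ double form on an $n$-dimensional Euclidean space $(V,g)$ with $n\ge 2p\ge 4$. Then $$\frac12\frac{\mathbf{c}^{2p-1}(\omega^2)}{(2p-1)!}=(-1)^p\frac{\mathbf{c}^{p-1}(\omega\circ\omega)}{(p-1)!}+\frac{\mathbf{c}^{p}\omega}{p!}\,\frac{\mathbf{c}^{p-1}\omega}{(p-1)!}+\sum_{r=1}^{p-1}(-1)^{r+p}\Bigl[\frac1{(r-1)!}\mathbf{c}^{r-1}\bigl(\iota_{\frac{\mathbf{c}^{r}\omega}{r!}}\omega\bigr)+\frac1{(p-r-1)!}\mathbf{c}^{p-r-1}\Bigl(\frac{\mathbf{c}^{r}\omega}{r!}\circ\frac{\mathbf{c}^{r}\omega}{r!}\Bigr)\Bigr].$$ If in addition $n=2p$, then $$\Bigl(\sum_{r=0}^{p}\frac{(-1)^{r+p}}{2}\Bigl\|\frac{\mathbf{c}^{r}\omega}{r!}\Bigr\|^2\Bigr) g=(-1)^p\frac{\mathbf{c}^{p-1}(\omega\circ\omega)}{(p-1)!}+\frac{\mathbf{c}^{p}\omega}{p!}\,\frac{\mathbf{c}^{p-1}\omega}{(p-1)!}+\sum_{r=1}^{p-1}(-1)^{r+p}\Bigl[\frac1{(r-1)!}\mathbf{c}^{r-1}\bigl(\iota_{\frac{\mathbf{c}^{r}\omega}{r!}}\omega\bigr)+\frac1{(p-r-1)!}\mathbf{c}^{p-r-1}\Bigl(\frac{\mathbf{c}^{r}\omega}{r!}\circ\frac{\mathbf{c}^{r}\ome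ga}{r!}\Bigr)\Bigr].$$
   Context: For a Euclidean space $(V,g)$ of dimension $n$, a $(p,q)$ double form is an element of $\Lambda^pV^*\otimes\Lambda^qV^*$; a $(p,p)$ double form is symmetric if it is invariant under exchanging the two factors. The exterior product of double forms is $(\alpha_1\otimes\beta_1)(\alpha_2\otimes\beta_2)=(\alpha_1\wedge\alpha_2)\otimes(\beta_1\wedge\beta_2)$, and $\omega^2$ is the square for this product. The metric $g=\sum e^i\otimes e^i$ is a $(1,1)$ double form. The inner product $\langle\cdot,\cdot\rangle$ is the one for which the $e^{i_1}\wedge\dots\wedge e^{i_p}\otimes e^{j_1}\wedge\dots\wedge e^{j_q}$ (increasing indices, $(e^i)$ orthonormal) form an orthonormal basis; $\|\omega\|^2=\langle\omega,\omega\rangle$. The interior product $\iota_\alpha$ by a double form $\alpha$ is the adjoint of left exterior multiplication: $\langle\iota_\alpha\beta,\gamma\rangle=\langle\beta,\alpha\gamma\rangle$. The contraction is $\mathbf{c}=\iota_g$, and $\mathbf{c}^k$ is its $k$-th iterate ($\mathbf{c}^0=\mathrm{id}$). The composition product $\circ$ of two $(q,q)$ double forms is composition of the corresponding endomorphisms of $\Lambda^qV$ (identified via the metric). *)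

theory Defs
  imports "HOL-Analysis.Analysis" "HOL-Library.Function_Algebras"
begin

text \<open>
  The Euclidean space \<open>V\<close> is a type of class \<open>euclidean_space\<close>, its metric is the inner product
  and its dimension is \<open>DIM('a)\<close>.  A \<open>p\<close>-form is an alternating multilinear function of lists
  of length \<open>p\<close>, extended by \<open>0\<close> to lists of all other lengths, and an element of
  \<open>\<Lambda>\<^sup>pV\<^sup>* \<otimes> \<Lambda>\<^sup>qV\<^sup>*\<close> is a function of two lists that is a \<open>p\<close>-form in the first and a \<open>q\<close>-form in
  the second.  Functions on lists of all lengths represent the inhomogeneous forms; as alternating
  forms of degree above \<open>DIM('a)\<close> vanish, these are exactly the (finite) sums of homogeneous ones.
  Sums of forms are the pointwise ones of \<open>Function_Algebras\<close>.
\<close>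

type_synonym 'a form = "'a list \<Rightarrow> real"
type_synonym 'a double_form = "'a list \<Rightarrow> 'a list \<Rightarrow> real"

definition alternating_form :: "'a::real_vector form \<Rightarrow> bool" where
  "alternating_form \<phi> \<longleftrightarrow>
     (\<forall>xs ys. linear (\<lambda>v. \<phi> (xs @ v # ys))) \<and> (\<forall>xs. \<not> distinct xs \<longrightarrow> \<phi> xs = 0)"

definition double_form :: "'a::real_vector double_form \<Rightarrow> bool" where
  "double_form \<omega> \<longleftrightarrow>
     (\<forall>xs. alternating_form (\<omega> xs)) \<and> (\<forall>ys. alternating_form (\<lambda>xs. \<omega> xs ys))"

definition double_forms :: "nat \<Rightarrow> nat \<Rightarrow> 'a::real_vector double_form set" where
  "double_forms p q =
     {\<omega>. double_form \<omega> \<and> (\<forall>xs ys. \<omega> xs ys \<noteq> 0 \<longrightarrow> length xs = p \<and> length ys = q)}"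

definition symmetric_form :: "'a double_form \<Rightarrow> bool" where
  "symmetric_form \<omega> \<longleftrightarrow> (\<forall>xs ys. \<omega> xs ys = \<omega> ys xs)"

definition dscale :: "real \<Rightarrow> 'a double_form \<Rightarrow> 'a double_form" (infixr "*\<^sub>d" 75) where
  "c *\<^sub>d \<omega> = (\<lambda>xs ys. c * \<omega> xs ys)"

definition tensor :: "'a form \<Rightarrow> 'a form \<Rightarrow> 'a double_form" where
  "tensor \<alpha> \<beta> = (\<lambda>xs ys. \<alpha> xs * \<beta> ys)"


text \<open>
  Wedge products are sums over shuffles, without factorials: the positions in \<open>A\<close> go to the first
  factor, the others to the second, and \<open>shuffle_sign A\<close> is the sign of that permutation.
\<close>

definition shuffle_sign :: "nat set \<Rightarrow> real" where
  "shuffle_sign A = (-1) ^ card {(i, j). i \<in> A \<and> j \<notin> A \<and> j < i}"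

definition wedge :: "'a form \<Rightarrow> 'a form \<Rightarrow> 'a form" where
  "wedge \<alpha> \<beta> = (\<lambda>xs. \<Sum>A\<in>Pow {..<length xs}.
     shuffle_sign A * \<alpha> (nths xs A) * \<beta> (nths xs (- A)))"

definition dprod :: "'a double_form \<Rightarrow> 'a double_form \<Rightarrow> 'a double_form" (infixl "\<and>\<^sub>d" 70) where
  "\<omega> \<and>\<^sub>d \<eta> = (\<lambda>xs ys. \<Sum>A\<in>Pow {..<length xs}. \<Sum>B\<in>Pow {..<length ys}.
     shuffle_sign A * shuffle_sign B *
     \<omega> (nths xs A) (nths ys B) * \<eta> (nths xs (- A)) (nths ys (- B)))"

lemma dprod_tensor:
  "tensor \<alpha>\<^sub>1 \<beta>\<^sub>1 \<and>\<^sub>d tensor \<alpha>\<^sub>2 \<beta>\<^sub>2 = tensor (wedge \<alpha>\<^sub>1 \<alpha>\<^sub>2) (wedge \<beta>\<^sub>1 \<beta>\<^sub>2)"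
  by (simp add: fun_eq_iff dprod_def tensor_def wedge_def sum_product mult_ac)


definition covector :: "'a::real_inner \<Rightarrow> 'a form" where
  "covector b = (\<lambda>xs. case xs of [v] \<Rightarrow> b \<bullet> v | _ \<Rightarrow> 0)"

definition metric_form :: "'a::euclidean_space double_form" where
  "metric_form = (\<Sum>b\<in>Basis. tensor (covector b) (covector b))"

lemma metric_form_singletons: "metric_form [v] [w] = v \<bullet> w"
proof -
  have "(\<Sum>b\<in>B. tensor (covector b) (covector b)) [v] [w] = (\<Sum>b\<in>B. (b \<bullet> v) * (b \<bullet> w))"
    if "finite B" for B
    using that by induction (simp_all add: tensor_def covector_def)
  then show ?thesis
    by (simp add: metric_form_def euclidean_inner[of v w] inner_commute)
qed


text \<open>
  An enumeration \<open>e\<^sub>0, e\<^sub>1, \<dots>\<close> of the orthonormal basis, so that the lists \<open>basis_tuple I\<close> for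
  \<open>I \<subseteq> {..<DIM('a)}\<close> are the tuples of basis vectors with increasing indices.  The coefficient of a
  double form at \<open>e\<^sup>I \<otimes> e\<^sup>J\<close> is its value at \<open>basis_tuple I\<close>, \<open>basis_tuple J\<close>.
\<close>

definition frame :: "'a::euclidean_space list" where
  "frame = (SOME bs. distinct bs \<and> set bs = Basis)"

definition basis_tuple :: "nat set \<Rightarrow> 'a::euclidean_space list" where
  "basis_tuple I = nths frame I"

definition form_inner :: "'a::euclidean_space double_form \<Rightarrow> 'a double_form \<Rightarrow> real" where
  "form_inner \<omega> \<eta> = (\<Sum>I\<in>Pow {..<DIM('a)}. \<Sum>J\<in>Pow {..<DIM('a)}.
     \<omega> (basis_tuple I) (basis_tuple J) * \<eta> (basis_tuple I) (basis_tuple J))"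

definition form_norm :: "'a::euclidean_space double_form \<Rightarrow> real" where
  "form_norm \<omega> = sqrt (form_inner \<omega> \<omega>)"


definition iprod :: "'a::euclidean_space double_form \<Rightarrow> 'a double_form \<Rightarrow> 'a double_form" where
  "iprod \<alpha> \<beta> = (THE \<delta>. double_form \<delta> \<and>
     (\<forall>\<gamma>. double_form \<gamma> \<longrightarrow> form_inner \<delta> \<gamma> = form_inner \<beta> (\<alpha> \<and>\<^sub>d \<gamma>)))"

definition contraction :: "'a::euclidean_space double_form \<Rightarrow> 'a double_form" where
  "contraction = iprod metric_form"

text \<open>The iterated contraction divided by a factorial, \<open>c\<^sup>k \<omega> / k!\<close>.\<close>

definition ncontr :: "nat \<Rightarrow> 'a::euclidean_space double_form \<Rightarrow> 'a double_form" where
  "ncontr k \<omega> = (1 / fact k) *\<^sub>d (contraction ^^ k) \<omega>"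


text \<open>
  The metric identifies \<open>\<Lambda>\<^sup>qV\<close> with the \<open>q\<close>-forms.  Under this identification the endomorphism
  given by \<open>\<omega>\<close> sends \<open>x\<^sub>1 \<and> \<dots> \<and> x\<^sub>q\<close> to \<open>\<omega> [x\<^sub>1, \<dots>, x\<^sub>q]\<close>, hence a form with coefficients
  \<open>\<phi> (basis_tuple I)\<close> to \<open>endo_of \<omega> \<phi>\<close> below.
\<close>

definition endo_of :: "'a::euclidean_space double_form \<Rightarrow> 'a form \<Rightarrow> 'a form" where
  "endo_of \<omega> \<phi> = (\<lambda>ys. \<Sum>I\<in>Pow {..<DIM('a)}. \<phi> (basis_tuple I) * \<omega> (basis_tuple I) ys)"

definition dcomp :: "'a::euclidean_space double_form \<Rightarrow> 'a double_form \<Rightarrow> 'a double_form"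
    (infixl "\<circ>\<^sub>d" 70) where
  "\<omega> \<circ>\<^sub>d \<eta> = (\<lambda>xs. endo_of \<omega> (\<eta> xs))"

lemma endo_of_dcomp: "endo_of (\<omega> \<circ>\<^sub>d \<eta>) = endo_of \<omega> \<circ> endo_of \<eta>"
proof (intro ext)
  fix \<phi> ys
  show "endo_of (\<omega> \<circ>\<^sub>d \<eta>) \<phi> ys = (endo_of \<omega> \<circ> endo_of \<eta>) \<phi> ys"
    unfolding endo_of_def dcomp_def comp_def sum_distrib_left sum_distrib_right
    by (subst sum.swap) (simp add: mult_ac)
qed

end

theory Submission
  imports Defs
begin

text \<open>
  Up to the factor \<open>k!\<close>, the iterated contraction \<open>c\<^sup>k\<close> is the sum over the \<open>k\<close>-element
  sublists \<open>K\<close> of the frame of the values at \<open>K @ xs\<close>, \<open>K @ ys\<close>.  By the Leibniz rule the value of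
  \<open>c\<^sup>2\<^sup>p\<^sup>-\<^sup>1(\<omega>\<^sup>2)\<close> at \<open>a\<close>, \<open>b\<close> is therefore a sum of traces of products of \<open>\<omega>\<close> with
  \<open>a\<close> and \<open>b\<close> inserted: both into the same factor, or into different ones.  All these traces are
  computed by one formula (\<open>trace_dprod\<close>), an alternating sum over four arbitrary sublists in which
  the overlaps cancel by inclusion-exclusion.  Sorted by the length \<open>r\<close> of the first sublist, the
  first kind of traces gives the terms with an interior product and the second kind the terms with a
  composition.  For \<open>n = 2p\<close> the form \<open>\<omega>\<^sup>2\<close> has top degree, so its contraction is a multiple of the metric
  and the same formula without insertions gives the factor.
\<close>

subsection \<open>Sums over the sublists of a list\<close>

text \<open>Summing over position sets makes the recursion on the first entry hold for any list,
  repeated entries included. Over \<open>frame\<close> the arguments are exactly the basis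
  tuples.\<close>

definition sublist_sum :: "'a list \<Rightarrow> ('a list \<Rightarrow> real) \<Rightarrow> real" where
  "sublist_sum bs f = (\<Sum>I\<in>Pow {..<length bs}. f (nths bs I))"

text \<open>Split by whether the set contains position 0. Sums over sublists and over shuffles
  thereby become recursions on the first list entry, which drive all later inductions.\<close>

lemma sum_Pow_lessThan_Suc:
  "(\<Sum>A\<in>Pow {..<Suc n}. f A) =
    (\<Sum>A\<in>Pow {..<n}. f (insert 0 (Suc ` A))) + (\<Sum>A\<in>Pow {..<n}. f (Suc ` A))"
  for f :: "nat set \<Rightarrow> 'b::comm_monoid_add"
proof -
  have "inj_on (\<lambda>A. insert 0 (Suc ` A)) X" for X
  proof (rule inj_onI)
    fix A B assume "insert 0 (Suc ` A) = insert 0 (Suc ` B)"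
    then have "Suc ` A = Suc ` B" by blast
    then show "A = B" by (simp add: inj_image_eq_iff)
  qed
  moreover have "inj_on (\<lambda>A. Suc ` A) X" for X
    by (simp add: inj_on_def inj_image_eq_iff)
  moreover have "Pow {..<Suc n} =
      (\<lambda>A. Suc ` A) ` Pow {..<n} \<union> (\<lambda>A. insert 0 (Suc ` A)) ` Pow {..<n}"
    unfolding lessThan_Suc_eq_insert_0 Pow_insert image_Pow_surj[OF refl, symmetric] image_image
    by simp
  moreover have "((\<lambda>A. Suc ` A) ` Pow {..<n}) \<inter> ((\<lambda>A. insert 0 (Suc ` A)) ` Pow {..<n}) = {}"
    by auto
  ultimately show ?thesis
    by (simp add: sum.union_disjoint sum.reindex add.commute)
qed

lemma nths_Cons_image_Suc [simp]:
  "nths (x # xs) (Suc ` A) = nths xs A"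
  "nths (x # xs) (insert 0 (Suc ` A)) = x # nths xs A"
  "nths (x # xs) (- Suc ` A) = x # nths xs (- A)"
  "nths (x # xs) (- insert 0 (Suc ` A)) = nths xs (- A)"
  by (auto simp: nths_Cons intro!: arg_cong[where f="nths xs"])

lemma sublist_sum_Nil [simp]: "sublist_sum [] f = f []"
  by (simp add: sublist_sum_def)

lemma sublist_sum_Cons [simp]:
  "sublist_sum (b # bs) f = sublist_sum bs (\<lambda>xs. f (b # xs)) + sublist_sum bs f"
  by (simp add: sublist_sum_def sum_Pow_lessThan_Suc)

lemma sublist_sum_add: "sublist_sum bs (\<lambda>x. f x + g x) = sublist_sum bs f + sublist_sum bs g"
  by (simp add: sublist_sum_def sum.distrib)

lemma sublist_sum_minus: "sublist_sum bs (\<lambda>x. - f x) = - sublist_sum bs f"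
  by (simp add: sublist_sum_def sum_negf)

lemma sublist_sum_diff: "sublist_sum bs (\<lambda>x. f x - g x) = sublist_sum bs f - sublist_sum bs g"
  by (simp add: sublist_sum_def sum_subtractf)

lemma sublist_sum_zero [simp]: "sublist_sum bs (\<lambda>x. 0) = 0"
  by (simp add: sublist_sum_def)

lemma sublist_sum_distrib_left: "c * sublist_sum bs f = sublist_sum bs (\<lambda>x. c * f x)"
  by (simp add: sublist_sum_def sum_distrib_left)

lemma sublist_sum_distrib_right: "sublist_sum bs f * c = sublist_sum bs (\<lambda>x. f x * c)"
  by (simp add: sublist_sum_def sum_distrib_right)

lemma sublist_sum_swap:
  "sublist_sum bs (\<lambda>x. sublist_sum cs (f x)) = sublist_sum cs (\<lambda>y. sublist_sum bs (\<lambda>x. f x y))"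
  unfolding sublist_sum_def by (rule sum.swap)

lemma sublist_sum_sum: "sublist_sum bs (\<lambda>x. \<Sum>i\<in>X. f i x) = (\<Sum>i\<in>X. sublist_sum bs (f i))"
  unfolding sublist_sum_def by (rule sum.swap)

lemma sublist_sum_cong:
  assumes "\<And>xs. set xs \<subseteq> set bs \<Longrightarrow> (distinct bs \<Longrightarrow> distinct xs) \<Longrightarrow> f xs = g xs"
  shows "sublist_sum bs f = sublist_sum bs g"
  unfolding sublist_sum_def
  by (intro sum.cong refl assms) (auto dest: in_set_nthsD)

lemma sublist_sum_cong_all: "(\<And>xs. f xs = g xs) \<Longrightarrow> sublist_sum bs f = sublist_sum bs g"
  by (rule arg_cong[of f g], rule ext)

lemma sublist_sum_neq_0E:
  assumes "sublist_sum bs f \<noteq> 0"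
  obtains xs where "f xs \<noteq> 0"
  using assms unfolding sublist_sum_def by (metis sum.neutral)

lemma sublist_sum_move_inwards:
  "sublist_sum bs (\<lambda>A. sublist_sum bs (\<lambda>B. sublist_sum bs (\<lambda>C. sublist_sum bs (f A B C)))) =
   sublist_sum bs (\<lambda>B. sublist_sum bs (\<lambda>C. sublist_sum bs (\<lambda>D. sublist_sum bs (\<lambda>A. f A B C D))))"
proof -
  let ?S = "sublist_sum bs"
  have "?S (\<lambda>A. ?S (\<lambda>B. ?S (\<lambda>C. ?S (f A B C)))) = ?S (\<lambda>B. ?S (\<lambda>A. ?S (\<lambda>C. ?S (f A B C))))"
    by (rule sublist_sum_swap)
  also have "\<dots> = ?S (\<lambda>B. ?S (\<lambda>C. ?S (\<lambda>A. ?S (f A B C))))"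
    by (intro sublist_sum_cong_all sublist_sum_swap)
  also have "\<dots> = ?S (\<lambda>B. ?S (\<lambda>C. ?S (\<lambda>D. ?S (\<lambda>A. f A B C D))))"
    by (intro sublist_sum_cong_all sublist_sum_swap)
  finally show ?thesis .
qed

lemma sublist_sum_reverse:
  "sublist_sum bs (\<lambda>A. sublist_sum bs (\<lambda>B. sublist_sum bs (\<lambda>C. sublist_sum bs (f A B C)))) =
   sublist_sum bs (\<lambda>D. sublist_sum bs (\<lambda>C. sublist_sum bs (\<lambda>B. sublist_sum bs (\<lambda>A. f A B C D))))"
proof -
  let ?S = "sublist_sum bs"
  have "?S (\<lambda>A. ?S (\<lambda>B. ?S (\<lambda>C. ?S (f A B C)))) = ?S (\<lambda>B. ?S (\<lambda>C. ?S (\<lambda>D. ?S (\<lambda>A. f A B C D))))"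
    by (rule sublist_sum_move_inwards)
  also have "\<dots> = ?S (\<lambda>C. ?S (\<lambda>B. ?S (\<lambda>D. ?S (\<lambda>A. f A B C D))))"
    by (rule sublist_sum_swap)
  also have "\<dots> = ?S (\<lambda>C. ?S (\<lambda>D. ?S (\<lambda>B. ?S (\<lambda>A. f A B C D))))"
    by (intro sublist_sum_cong_all sublist_sum_swap)
  also have "\<dots> = ?S (\<lambda>D. ?S (\<lambda>C. ?S (\<lambda>B. ?S (\<lambda>A. f A B C D))))"
    by (rule sublist_sum_swap)
  finally show ?thesis .
qed

lemma sublist_sum_Nil_only:
  assumes "\<And>xs. xs \<noteq> [] \<Longrightarrow> f xs = 0"
  shows "sublist_sum bs f = f []"
  using assms by (induction bs) auto

lemma sublist_sum_singletons_only:
  assumes "\<And>xs. length xs \<noteq> 1 \<Longrightarrow> f xs = 0"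
  shows "sublist_sum bs f = (\<Sum>b\<leftarrow>bs. f [b])"
proof (induction bs)
  case Nil
  show ?case using assms[of "[]"] by simp
next
  case (Cons b bs)
  have "sublist_sum bs (\<lambda>xs. f (b # xs)) = f [b]"
    by (rule sublist_sum_Nil_only) (simp add: assms)
  with Cons show ?case by simp
qed

text \<open>Grading by length is the source of the summation index \<open>r\<close> of the theorem;
  \<open>X\<close> has to contain only the lengths that occur on the support of
  \<open>f\<close>.\<close>

lemma sublist_sum_split_length:
  assumes "finite X" and "\<And>xs. f xs \<noteq> 0 \<Longrightarrow> length xs \<in> X"
  shows "sublist_sum bs f = (\<Sum>r\<in>X. sublist_sum bs (\<lambda>xs. of_bool (length xs = r) * f xs))"
proof -
  have "f xs = (\<Sum>r\<in>X. of_bool (length xs = r) * f xs)" for xs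
    using assms by (cases "f xs = 0") (auto simp: of_bool_def if_distrib [where f="\<lambda>a. a * _"] cong: if_cong)
  then show ?thesis
    by (simp add: sublist_sum_sum [symmetric])
qed

lemma sublist_sum_longer:
  "n > length bs \<Longrightarrow> sublist_sum bs (\<lambda>xs. of_bool (length xs = n) * f xs) = 0"
proof (induction bs arbitrary: n f)
  case Nil
  then show ?case by simp
next
  case (Cons b bs)
  then obtain m where "n = Suc m" by (cases n) auto
  with Cons.prems Cons.IH[of m "\<lambda>xs. f (b # xs)"] Cons.IH[of n f] show ?case by simp
qed

lemma sublist_sum_full_length:
  "sublist_sum bs (\<lambda>xs. of_bool (length xs = length bs) * f xs) = f bs"
proof (induction bs arbitrary: f)
  case (Cons b bs)
  from Cons[of "\<lambda>xs. f (b # xs)"] show ?case by (simp add: sublist_sum_longer)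
qed simp

subsection \<open>Alternating forms\<close>

lemma alternating_form_linear:
  "alternating_form \<phi> \<Longrightarrow> linear (\<lambda>v. \<phi> (xs @ v # ys))"
  by (simp add: alternating_form_def)

lemma alternating_form_not_distinct:
  "alternating_form \<phi> \<Longrightarrow> \<not> distinct xs \<Longrightarrow> \<phi> xs = 0"
  by (simp add: alternating_form_def)

text \<open>Polarization: expand the value at two neighbouring entries \<open>u + v\<close>. Only
  the vanishing at equal neighbours is assumed, so that the lemma can also serve to establish
  alternation.\<close>

lemma swap_adjacent:
  assumes lin: "\<And>xs ys. linear (\<lambda>v. \<phi> (xs @ v # ys))"
    and adj: "\<And>xs v ys. \<phi> (xs @ v # v # ys) = 0"
  shows "\<phi> (xs @ u # v # ys) = - (\<phi> (xs @ v # u # ys) :: real)"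
proof -
  have fst: "\<phi> (xs @ (a + b) # zs) = \<phi> (xs @ a # zs) + \<phi> (xs @ b # zs)" for a b zs
    using lin by (rule linear_add)
  have snd: "\<phi> (xs @ c # (a + b) # zs) = \<phi> (xs @ c # a # zs) + \<phi> (xs @ c # b # zs)" for a b c zs
    using linear_add[OF lin[of "xs @ [c]" zs], of a b] by simp
  from adj[of xs "u + v" ys] adj[of xs u ys] adj[of xs v ys] show ?thesis
    by (simp add: fst snd)
qed

lemma alternating_form_swap:
  assumes "alternating_form \<phi>"
  shows "\<phi> (xs @ u # v # ys) = - \<phi> (xs @ v # u # ys)"
  by (rule swap_adjacent) (use assms in \<open>simp_all add: alternating_form_def\<close>)

lemma alternating_form_move:
  assumes "alternating_form \<phi>"
  shows "\<phi> (us @ v # ws) = (-1) ^ length us * \<phi> (v # us @ ws)"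
proof (induction us arbitrary: ws rule: rev_induct)
  case (snoc u us)
  then show ?case
    using alternating_form_swap[OF assms, of us u v ws] by simp
qed simp

lemma alternating_form_rotate:
  assumes "alternating_form \<phi>"
  shows "\<phi> (xs @ ys @ zs) = (-1) ^ (length xs * length ys) * \<phi> (ys @ xs @ zs)"
proof (induction ys arbitrary: zs rule: rev_induct)
  case (snoc y ys)
  have "\<phi> (xs @ (ys @ [y]) @ zs) = (-1) ^ (length xs * length ys) * \<phi> (ys @ xs @ y # zs)"
    using snoc[of "y # zs"] by simp
  also have "\<phi> (ys @ xs @ y # zs) = (-1) ^ length xs * \<phi> (ys @ y # xs @ zs)"
    using alternating_form_move[OF assms, of "ys @ xs" y zs]
      alternating_form_move[OF assms, of ys y "xs @ zs"]
    by (simp add: power_add mult_ac)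
  finally show ?case
    by (simp add: power_add mult_ac algebra_simps)
qed simp

lemma alternating_form_prefix:
  assumes "alternating_form \<phi>"
  shows "alternating_form (\<lambda>xs. \<phi> (us @ xs))"
  unfolding alternating_form_def
  using alternating_form_linear[OF assms, of "us @ _"] alternating_form_not_distinct[OF assms]
  by auto

lemma alternating_form_Cons: "alternating_form \<phi> \<Longrightarrow> alternating_form (\<lambda>xs. \<phi> (v # xs))"
  using alternating_form_prefix[of \<phi> "[v]"] by simp

lemma alternating_form_add:
  "alternating_form \<phi> \<Longrightarrow> alternating_form \<psi> \<Longrightarrow> alternating_form (\<lambda>xs. \<phi> xs + \<psi> xs)"
  by (simp add: alternating_form_def linear_compose_add)

lemma alternating_form_scale:
  "alternating_form \<phi> \<Longrightarrow> alternating_form (\<lambda>xs. c * \<phi> xs)"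
  using linear_compose_scale_right[of "\<lambda>v. \<phi> (_ @ v # _)" c]
  by (simp add: alternating_form_def)

lemma alternating_form_sum:
  "(\<And>i. i \<in> X \<Longrightarrow> alternating_form (\<phi> i)) \<Longrightarrow> alternating_form (\<lambda>xs. \<Sum>i\<in>X. \<phi> i xs)"
  by (simp add: alternating_form_def linear_compose_sum)

text \<open>The length stays fixed while one entry varies, so the sign acts as a constant factor
  there.\<close>

lemma alternating_form_length_sign:
  assumes "alternating_form \<phi>"
  shows "alternating_form (\<lambda>xs. (-1) ^ length xs * \<phi> xs)"
proof -
  have "linear (\<lambda>v. (-1) ^ length (xs @ v # ys) * \<phi> (xs @ v # ys))" for xs ys
    using linear_compose_scale_right[OF alternating_form_linear[OF assms, of xs ys],
        of "(-1) ^ (length xs + Suc (length ys))"]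
    by (simp del: power_Suc mult_minus_left mult_minus1)
  then show ?thesis
    using alternating_form_not_distinct[OF assms] unfolding alternating_form_def by (metis mult_zero_right)
qed

text \<open>Adjacent swaps bring two equal entries together. For exterior products only the case of
  equal neighbours is then left to check.\<close>

lemma alternating_formI_adjacent:
  assumes lin: "\<And>xs ys. linear (\<lambda>v. \<phi> (xs @ v # ys))"
    and adj: "\<And>xs v ys. \<phi> (xs @ v # v # ys) = 0"
  shows "alternating_form \<phi>"
proof -
  have "\<phi> (xs @ v # ys @ v # zs) = 0" for xs v ys zs
  proof (induction ys arbitrary: zs rule: rev_induct)
    case (snoc y ys)
    then show ?case using swap_adjacent[of \<phi> "xs @ v # ys" y v zs, OF assms] by simp
  qed (simp add: adj)
  then show ?thesis
    unfolding alternating_form_def using lin not_distinct_decomp by fastforce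
qed

lemma double_form_alternating:
  assumes "double_form \<omega>"
  shows "alternating_form (\<omega> xs)" "alternating_form (\<lambda>xs. \<omega> xs ys)"
  using assms by (auto simp: double_form_def)

subsection \<open>The Leibniz rule\<close>

definition flip :: "'a double_form \<Rightarrow> 'a double_form" where
  "flip \<omega> = (\<lambda>xs ys. \<omega> ys xs)"

definition lins :: "'a \<Rightarrow> 'a double_form \<Rightarrow> 'a double_form" where
  "lins v \<omega> = (\<lambda>xs ys. \<omega> (v # xs) ys)"

definition rins :: "'a \<Rightarrow> 'a double_form \<Rightarrow> 'a double_form" where
  "rins v \<omega> = (\<lambda>xs ys. \<omega> xs (v # ys))"

text \<open>The degree involution in one slot, that is, the sign of moving a vector past the first
  factor in the Leibniz rule.\<close>

definition lsign :: "'a double_form \<Rightarrow> 'a double_form" where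
  "lsign \<omega> = (\<lambda>xs ys. (-1) ^ length xs * \<omega> xs ys)"

definition rsign :: "'a double_form \<Rightarrow> 'a double_form" where
  "rsign \<omega> = (\<lambda>xs ys. (-1) ^ length ys * \<omega> xs ys)"

lemma ins_sign_apply [simp]:
  "flip \<omega> xs ys = \<omega> ys xs"
  "lins v \<omega> xs ys = \<omega> (v # xs) ys"
  "rins v \<omega> xs ys = \<omega> xs (v # ys)"
  "lsign \<omega> xs ys = (-1) ^ length xs * \<omega> xs ys"
  "rsign \<omega> xs ys = (-1) ^ length ys * \<omega> xs ys"
  by (simp_all add: flip_def lins_def rins_def lsign_def rsign_def)

lemma double_form_flip: "double_form \<omega> \<Longrightarrow> double_form (flip \<omega>)"
  by (simp add: double_form_def flip_def)

lemma double_form_lins: "double_form \<omega> \<Longrightarrow> double_form (lins v \<omega>)"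
  unfolding double_form_def lins_def using alternating_form_Cons[of "\<lambda>xs. \<omega> xs _"] by blast

lemma double_form_rins: "double_form \<omega> \<Longrightarrow> double_form (rins v \<omega>)"
  by (simp add: double_form_def rins_def alternating_form_Cons)

lemma double_form_lsign: "double_form \<omega> \<Longrightarrow> double_form (lsign \<omega>)"
  by (simp add: double_form_def lsign_def alternating_form_length_sign alternating_form_scale)

lemma double_form_rsign: "double_form \<omega> \<Longrightarrow> double_form (rsign \<omega>)"
  by (simp add: double_form_def rsign_def alternating_form_length_sign alternating_form_scale)

lemma flip_ins_sign:
  "flip (lins v \<omega>) = rins v (flip \<omega>)" "flip (lsign \<omega>) = rsign (flip \<omega>)"
  "flip (rins v \<omega>) = lins v (flip \<omega>)" "flip (rsign \<omega>) = lsign (flip \<omega>)"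
  "flip (flip \<omega>) = \<omega>"
  by (simp_all add: fun_eq_iff)

lemma dprod_flip: "(\<omega> \<and>\<^sub>d \<eta>) xs ys = (flip \<omega> \<and>\<^sub>d flip \<eta>) ys xs"
  unfolding dprod_def flip_def by (subst sum.swap) (simp add: mult_ac)

text \<open>Position 0 in the first block has no smaller position before it, so no new inversion
  arises.\<close>

lemma shuffle_sign_insert_0: "shuffle_sign (insert 0 (Suc ` A)) = shuffle_sign A"
proof -
  have "{(i, j). i \<in> insert 0 (Suc ` A) \<and> j \<notin> insert 0 (Suc ` A) \<and> j < i} =
      map_prod Suc Suc ` {(i, j). i \<in> A \<and> j \<notin> A \<and> j < i}"
  proof (rule set_eqI, clarify)
    fix i j
    show "(i, j) \<in> {(i, j). i \<in> insert 0 (Suc ` A) \<and> j \<notin> insert 0 (Suc ` A) \<and> j < i} \<longleftrightarrow>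
      (i, j) \<in> map_prod Suc Suc ` {(i, j). i \<in> A \<and> j \<notin> A \<and> j < i}"
      by (cases i; cases j) (auto simp: image_iff)
  qed
  moreover have "card (map_prod Suc Suc ` S) = card S" for S
    by (intro card_image) (auto simp: inj_on_def)
  ultimately show ?thesis
    by (simp add: shuffle_sign_def)
qed

text \<open>Position 0 now lies in the second block and below every element of the first, which adds
  one inversion for each element of \<open>A\<close>.\<close>

lemma shuffle_sign_image_Suc:
  assumes "finite A"
  shows "shuffle_sign (Suc ` A) = (-1) ^ card A * shuffle_sign A"
proof -
  let ?S = "{(i, j). i \<in> A \<and> j \<notin> A \<and> j < i}"
  have "{(i, j). i \<in> Suc ` A \<and> j \<notin> Suc ` A \<and> j < i} =
      map_prod Suc Suc ` ?S \<union> (\<lambda>i. (Suc i, 0)) ` A"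
  proof (rule set_eqI, clarify)
    fix i j
    show "(i, j) \<in> {(i, j). i \<in> Suc ` A \<and> j \<notin> Suc ` A \<and> j < i} \<longleftrightarrow>
      (i, j) \<in> map_prod Suc Suc ` ?S \<union> (\<lambda>i. (Suc i, 0)) ` A"
      by (cases i; cases j) (auto simp: image_iff)
  qed
  moreover have "finite ?S"
    by (rule finite_subset[of _ "Sigma A (\<lambda>i. {..<i})"]) (use assms in auto)
  moreover have "card (map_prod Suc Suc ` ?S) = card ?S"
    by (intro card_image) (auto simp: inj_on_def)
  moreover have "card ((\<lambda>i. (Suc i, 0::nat)) ` A) = card A"
    by (intro card_image) (auto simp: inj_on_def)
  moreover have "map_prod Suc Suc ` ?S \<inter> (\<lambda>i. (Suc i, 0)) ` A = {}"
    by auto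
  ultimately show ?thesis
    using assms by (simp add: shuffle_sign_def card_Un_disjoint power_add)
qed

lemma length_nths_subset:
  assumes "A \<subseteq> {..<length xs}" shows "length (nths xs A) = card A"
proof -
  have "{i. i < length xs \<and> i \<in> A} = A" using assms by auto
  then show ?thesis by (simp add: length_nths)
qed

lemma dprod_Nil: "(\<omega> \<and>\<^sub>d \<eta>) [] [] = \<omega> [] [] * \<eta> [] []"
  by (simp add: dprod_def shuffle_sign_def)

text \<open>Inserting a vector is an antiderivation: position 0 goes to the first factor without a
  sign, or to the second after passing the whole first factor, whence \<open>lsign\<close>.\<close>

lemma dprod_Cons_left:
  "(\<omega> \<and>\<^sub>d \<eta>) (v # xs) ys = (lins v \<omega> \<and>\<^sub>d \<eta>) xs ys + (lsign \<omega> \<and>\<^sub>d lins v \<eta>) xs ys"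
proof -
  have "(\<Sum>A\<in>Pow {..<length xs}. \<Sum>B\<in>Pow {..<length ys}.
      shuffle_sign (Suc ` A) * shuffle_sign B * \<omega> (nths (v # xs) (Suc ` A)) (nths ys B) *
      \<eta> (nths (v # xs) (- Suc ` A)) (nths ys (- B))) = (lsign \<omega> \<and>\<^sub>d lins v \<eta>) xs ys"
    unfolding dprod_def
  proof (intro sum.cong refl)
    fix A B assume "A \<in> Pow {..<length xs}"
    then have "length (nths xs A) = card A" "finite A"
      by (auto simp: length_nths_subset intro: finite_subset)
    then show "shuffle_sign (Suc ` A) * shuffle_sign B * \<omega> (nths (v # xs) (Suc ` A)) (nths ys B) *
      \<eta> (nths (v # xs) (- Suc ` A)) (nths ys (- B)) =
      shuffle_sign A * shuffle_sign B * lsign \<omega> (nths xs A) (nths ys B) *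
      lins v \<eta> (nths xs (- A)) (nths ys (- B))"
      by (simp add: shuffle_sign_image_Suc)
  qed
  then show ?thesis
    by (simp add: dprod_def sum_Pow_lessThan_Suc shuffle_sign_insert_0)
qed

lemma dprod_Cons_right:
  "(\<omega> \<and>\<^sub>d \<eta>) xs (v # ys) = (rins v \<omega> \<and>\<^sub>d \<eta>) xs ys + (rsign \<omega> \<and>\<^sub>d rins v \<eta>) xs ys"
  by (simp add: dprod_flip[of _ _ xs] dprod_Cons_left flip_ins_sign)

lemma dprod_eq_0I:
  assumes "\<And>us vs us' vs'. \<omega> us vs * \<eta> us' vs' = 0"
  shows "(\<omega> \<and>\<^sub>d \<eta>) xs ys = 0"
  unfolding dprod_def by (intro sum.neutral ballI) (use assms in \<open>auto simp: mult.assoc\<close>)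

text \<open>The Leibniz rule strips the entries of \<open>us\<close> one by one, changing the two
  factors, until \<open>v\<close> stands in front and enters exactly one factor in each
  term.\<close>

lemma linear_dprod_Cons_right:
  assumes "double_form \<omega>" "double_form \<eta>"
  shows "linear (\<lambda>v. (\<omega> \<and>\<^sub>d \<eta>) xs (us @ v # ws))"
  using assms
proof (induction us arbitrary: \<omega> \<eta>)
  case Nil
  have lin: "linear (\<lambda>v. \<omega> as (v # bs))" "linear (\<lambda>v. \<eta> as (v # bs))" for as bs
    using Nil double_form_alternating(1) alternating_form_linear[of _ "[]"] by auto
  have "linear (\<lambda>v. a * \<omega> as (v # bs) * b)" for a b as bs
    using linear_compose_scale_right[OF lin(1), of "a * b"] by (simp add: mult_ac)
  moreover have "linear (\<lambda>v. b * \<eta> as (v # bs))" for b as bs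
    using linear_compose_scale_right[OF lin(2), of b] by simp
  ultimately show ?case
    unfolding dprod_Cons_right append_Nil
    unfolding dprod_def rins_def
    by (intro linear_compose_add linear_compose_sum ballI)
next
  case (Cons u us)
  from Cons.IH[OF double_form_rins[OF Cons.prems(1)] Cons.prems(2)]
    Cons.IH[OF double_form_rsign[OF Cons.prems(1)] double_form_rins[OF Cons.prems(2)]]
  show ?case
    unfolding append_Cons dprod_Cons_right by (rule linear_compose_add)
qed

lemma dprod_right_adjacent:
  assumes "double_form \<omega>" "double_form \<eta>"
  shows "(\<omega> \<and>\<^sub>d \<eta>) xs (us @ v # v # ws) = 0"
  using assms
proof (induction us arbitrary: \<omega> \<eta>)
  case Nil
  have "\<omega> as (v # v # bs) = 0" "\<eta> as (v # v # bs) = 0" for as bs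
    using Nil[THEN double_form_alternating(1)] by (simp_all add: alternating_form_not_distinct)
  then have "(rins v (rins v \<omega>) \<and>\<^sub>d \<eta>) xs ws = 0"
    "(rsign (rsign \<omega>) \<and>\<^sub>d rins v (rins v \<eta>)) xs ws = 0"
    by (simp_all add: dprod_eq_0I)
  \<comment> \<open>One copy of \<open>v\<close> in each factor: \<open>rins v\<close> and
    \<open>rsign\<close> anticommute, so these two mixed terms cancel.\<close>
  moreover have "(rins v (rsign \<omega>) \<and>\<^sub>d rins v \<eta>) xs ws = - (rsign (rins v \<omega>) \<and>\<^sub>d rins v \<eta>) xs ws"
    by (simp add: dprod_def sum_negf)
  ultimately show ?case
    by (simp add: dprod_Cons_right)
next
  case (Cons u us)
  then show ?case
    unfolding append_Cons dprod_Cons_right by (metis double_form_rins double_form_rsign add.left_neutral)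
qed

lemma alternating_form_dprod_right:
  assumes "double_form \<omega>" "double_form \<eta>"
  shows "alternating_form ((\<omega> \<and>\<^sub>d \<eta>) xs)"
  using linear_dprod_Cons_right[OF assms] dprod_right_adjacent[OF assms]
  by (rule alternating_formI_adjacent)

lemma double_form_dprod:
  assumes "double_form \<omega>" "double_form \<eta>"
  shows "double_form (\<omega> \<and>\<^sub>d \<eta>)"
  using alternating_form_dprod_right[OF assms]
    alternating_form_dprod_right[OF assms[THEN double_form_flip]]
  by (simp add: double_form_def dprod_flip[of \<omega> \<eta>])

lemma dprod_double_forms:
  assumes "\<omega> \<in> double_forms p q" "\<eta> \<in> double_forms p' q'"
  shows "\<omega> \<and>\<^sub>d \<eta> \<in> double_forms (p + p') (q + q')"
proof -
  have len: "length (nths xs A) + length (nths xs (- A)) = length xs" for xs :: "'a list" and A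
    using sum_length_filter_compl[of "\<lambda>p. snd p \<in> A" "zip xs [0..<length xs]"]
    by (simp add: nths_def)
  have "length xs = p + p' \<and> length ys = q + q'" if nz: "(\<omega> \<and>\<^sub>d \<eta>) xs ys \<noteq> 0" for xs ys
  proof -
    from nz obtain A where "(\<Sum>B\<in>Pow {..<length ys}. shuffle_sign A * shuffle_sign B *
        \<omega> (nths xs A) (nths ys B) * \<eta> (nths xs (- A)) (nths ys (- B))) \<noteq> 0"
      unfolding dprod_def by (metis (no_types, lifting) sum.neutral)
    then obtain B where "shuffle_sign A * shuffle_sign B *
        \<omega> (nths xs A) (nths ys B) * \<eta> (nths xs (- A)) (nths ys (- B)) \<noteq> 0"
      by (metis (no_types, lifting) sum.neutral)
    then show ?thesis
      using assms len[of xs A] len[of ys B] by (auto simp: double_forms_def)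
  qed
  with assms show ?thesis
    by (simp add: double_forms_def double_form_dprod)
qed

lemma double_forms_eq_0:
  "\<omega> \<in> double_forms p q \<Longrightarrow> length xs \<noteq> p \<or> length ys \<noteq> q \<Longrightarrow> \<omega> xs ys = 0"
  by (auto simp: double_forms_def)

lemma double_form_not_distinct:
  assumes "double_form \<omega>" "\<not> distinct xs \<or> \<not> distinct ys"
  shows "\<omega> xs ys = 0"
  using assms double_form_alternating alternating_form_not_distinct by metis

subsection \<open>Interior products\<close>

lemma frame: "distinct (frame :: 'a::euclidean_space list)" "set (frame :: 'a list) = Basis"
proof -
  have "\<exists>bs. distinct bs \<and> set bs = (Basis :: 'a set)"
    using finite_distinct_list[OF finite_Basis] by blast
  from someI_ex[OF this] show "distinct (frame :: 'a list)" "set (frame :: 'a list) = Basis"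
    by (auto simp: frame_def)
qed

section \<open>Separation of forms by basis tuples, and definiteness of the inner product\<close>

lemma length_frame: "length (frame :: 'a::euclidean_space list) = DIM('a)"
  using frame distinct_card by metis

text \<open>The sum of squares encodes vanishing on all sublists in a way that splits along the
  list. If the head \<open>b\<close> occurs in \<open>xs\<close>, moving it to the front reduces to
  the form with \<open>b\<close> inserted.\<close>

lemma alternating_form_eq_0_on_lists:
  assumes "alternating_form \<phi>" "sublist_sum bs (\<lambda>xs. (\<phi> xs)\<^sup>2) = 0" "set xs \<subseteq> set bs"
  shows "\<phi> xs = 0"
  using assms
proof (induction bs arbitrary: \<phi> xs)
  case (Cons b bs)
  have nonneg: "sublist_sum bs (\<lambda>xs. (\<psi> xs)\<^sup>2) \<ge> 0" for \<psi>
    by (simp add: sublist_sum_def sum_nonneg)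
  have zero: "sublist_sum bs (\<lambda>xs. (\<phi> (b # xs))\<^sup>2) = 0" "sublist_sum bs (\<lambda>xs. (\<phi> xs)\<^sup>2) = 0"
    using Cons.prems(2) nonneg[of \<phi>] nonneg[of "\<lambda>xs. \<phi> (b # xs)"] by simp_all
  show ?case
  proof (cases "distinct xs \<and> b \<in> set xs")
    case True
    then obtain us vs where xs: "xs = us @ b # vs" "b \<notin> set us" "b \<notin> set vs"
      by (metis split_list distinct_append distinct.simps(2) disjoint_insert(1) list.simps(15))
    then have "\<phi> (b # us @ vs) = 0"
      using Cons.prems by (intro Cons.IH[OF alternating_form_Cons zero(1)]) auto
    then show ?thesis
      using alternating_form_move[OF Cons.prems(1), of us b vs] by (simp add: xs)
  next
    case False
    then show ?thesis
      using Cons.IH[OF Cons.prems(1) zero(2), of xs] Cons.prems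
        alternating_form_not_distinct[OF Cons.prems(1), of xs] by auto
  qed
qed auto

text \<open>Multilinear extension one entry at a time: inserting an arbitrary first vector keeps the
  vanishing on basis lists.\<close>

lemma alternating_form_eq_0_Basis:
  assumes "alternating_form (\<phi> :: 'a::euclidean_space form)" "\<And>xs. set xs \<subseteq> Basis \<Longrightarrow> \<phi> xs = 0"
  shows "\<phi> xs = 0"
  using assms
proof (induction xs arbitrary: \<phi>)
  case (Cons v xs)
  have "\<phi> (v # ys) = 0" if "set ys \<subseteq> Basis" for ys
  proof -
    have "(\<lambda>v. \<phi> (v # ys)) = (\<lambda>v. 0)"
      by (rule linear_eq_stdbasis)
        (use that Cons.prems alternating_form_linear[of \<phi> "[]"] in \<open>auto simp: module_hom_zero\<close>)
    then show ?thesis by meson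
  qed
  then show ?case
    using Cons.IH[OF alternating_form_Cons[OF Cons.prems(1)]] by blast
qed simp

lemma alternating_form_eq_0_frame:
  assumes "alternating_form (\<phi> :: 'a::euclidean_space form)"
    and "\<And>I. I \<subseteq> {..<DIM('a)} \<Longrightarrow> \<phi> (basis_tuple I) = 0"
  shows "\<phi> xs = 0"
proof (rule alternating_form_eq_0_Basis[OF assms(1)])
  fix xs :: "'a list" assume "set xs \<subseteq> Basis"
  moreover have "sublist_sum frame (\<lambda>xs. (\<phi> xs)\<^sup>2) = 0"
    using assms(2) by (simp add: sublist_sum_def length_frame basis_tuple_def [symmetric])
  ultimately show "\<phi> xs = 0"
    using alternating_form_eq_0_on_lists[OF assms(1)] frame(2) by metis
qed

lemma double_form_eq_0_frame:
  assumes "double_form (\<omega> :: 'a::euclidean_space double_form)"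
    and "\<And>I J. I \<subseteq> {..<DIM('a)} \<Longrightarrow> J \<subseteq> {..<DIM('a)} \<Longrightarrow> \<omega> (basis_tuple I) (basis_tuple J) = 0"
  shows "\<omega> xs ys = 0"
proof -
  have "\<omega> (basis_tuple I) ys = 0" if "I \<subseteq> {..<DIM('a)}" for I
    using double_form_alternating(1)[OF assms(1)] assms(2)[OF that]
    by (rule alternating_form_eq_0_frame)
  with double_form_alternating(2)[OF assms(1)] show ?thesis
    by (rule alternating_form_eq_0_frame)
qed

lemma form_inner_eq:
  "form_inner \<omega> \<eta> = sublist_sum frame (\<lambda>xs. sublist_sum frame (\<lambda>ys. \<omega> xs ys * \<eta> xs ys))"
  for \<omega> :: "'a::euclidean_space double_form"
  by (simp add: form_inner_def sublist_sum_def basis_tuple_def length_frame)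

text \<open>A vanishing sum of squares vanishes termwise, and values at basis tuples determine a
  double form. This gives the uniqueness of adjoints.\<close>

lemma form_inner_self_eq_0:
  assumes "double_form (\<omega> :: 'a::euclidean_space double_form)" "form_inner \<omega> \<omega> = 0"
  shows "\<omega> = 0"
proof -
  have "\<omega> (basis_tuple I) (basis_tuple J) = 0" if "I \<subseteq> {..<DIM('a)}" "J \<subseteq> {..<DIM('a)}" for I J
    using assms(2) that unfolding form_inner_def
    by (subst (asm) sum_nonneg_eq_0_iff, simp, simp add: sum_nonneg,
        subst (asm) sum_nonneg_eq_0_iff) (auto)
  then show ?thesis
    using double_form_eq_0_frame[OF assms(1)] by (simp add: fun_eq_iff)
qed

lemma form_norm_power2: "(form_norm \<omega>)\<^sup>2 = form_inner \<omega> \<omega>"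
  by (simp add: form_norm_def form_inner_def sum_nonneg)

section \<open>An explicit formula for the interior product\<close>

lemma double_form_diff:
  assumes "double_form \<omega>" "double_form \<eta>"
  shows "double_form (\<lambda>xs ys. \<omega> xs ys - \<eta> xs ys)"
proof -
  have "alternating_form (\<lambda>xs. \<phi> xs - \<psi> xs)" if "alternating_form \<phi>" "alternating_form \<psi>" for \<phi> \<psi>
    using that by (simp add: alternating_form_def linear_compose_sub)
  with assms show ?thesis unfolding double_form_def by blast
qed

lemma double_form_scale: "double_form \<omega> \<Longrightarrow> double_form (\<lambda>xs ys. c * \<omega> xs ys)"
  by (simp add: double_form_def alternating_form_scale)

lemma double_form_sum:
  "(\<And>i. i \<in> X \<Longrightarrow> double_form (\<omega> i)) \<Longrightarrow> double_form (\<lambda>xs ys. \<Sum>i\<in>X. \<omega> i xs ys)"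
  by (simp add: double_form_def alternating_form_sum)

lemma double_form_prefix:
  assumes "double_form \<omega>" shows "double_form (\<lambda>xs ys. \<omega> (us @ xs) (vs @ ys))"
  using alternating_form_prefix[of "\<omega> _"] alternating_form_prefix[of "\<lambda>xs. \<omega> xs _"] assms
  by (simp add: double_form_def)

lemma double_form_suffix:
  assumes "double_form \<omega>" shows "double_form (\<lambda>xs ys. \<omega> (xs @ us) (ys @ vs))"
proof -
  have "alternating_form (\<lambda>xs. \<phi> (xs @ us))" if "alternating_form \<phi>" for \<phi> and us :: "'a list"
    using that by (auto simp: alternating_form_def)
  from this[of "\<omega> _"] this[of "\<lambda>xs. \<omega> xs _"] assms show ?thesis
    by (simp add: double_form_def)
qed

text \<open>The candidate for the adjoint of left multiplication by \<open>\<alpha>\<close>; the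
  basis tuples are inserted in front because \<open>\<alpha>\<close> multiplies from the
  left.\<close>

definition interior :: "'a::euclidean_space double_form \<Rightarrow> 'a double_form \<Rightarrow> 'a double_form" where
  "interior \<alpha> \<beta> = (\<lambda>xs ys. sublist_sum frame (\<lambda>P. sublist_sum frame (\<lambda>Q.
     \<alpha> P Q * \<beta> (P @ xs) (Q @ ys))))"

lemma double_form_interior: "double_form \<beta> \<Longrightarrow> double_form (interior \<alpha> \<beta>)"
  unfolding interior_def sublist_sum_def
  by (intro double_form_sum double_form_scale double_form_prefix)

lemma double_form_Cons_append:
  assumes "double_form \<omega>"
  shows "\<omega> (us @ v # ws) ys = (-1) ^ length us * \<omega> (v # us @ ws) ys"
    and "\<omega> xs (us @ v # ws) = (-1) ^ length us * \<omega> xs (v # us @ ws)"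
  using alternating_form_move[OF double_form_alternating(1)[OF assms]]
    alternating_form_move[OF double_form_alternating(2)[OF assms]] by simp_all

text \<open>A pair \<open>P\<close>, \<open>I\<close> without common positions is a shuffle of one
  sublist \<open>K\<close>; a pair with a common position gives \<open>\<beta>\<close> a repeated
  entry and contributes 0. Separate lists \<open>bs\<close> and \<open>cs\<close> for the two slots
  allow one induction inside the other.\<close>

lemma sum_interior_adjoint:
  assumes "double_form \<beta>"
  shows "sublist_sum bs (\<lambda>I. sublist_sum bs (\<lambda>P. sublist_sum cs (\<lambda>J. sublist_sum cs (\<lambda>Q.
      \<alpha> P Q * \<beta> (P @ I) (Q @ J) * \<gamma> I J)))) =
    sublist_sum bs (\<lambda>K. sublist_sum cs (\<lambda>L. \<beta> K L * (\<alpha> \<and>\<^sub>d \<gamma>) K L))"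
  using assms
proof (induction bs arbitrary: \<alpha> \<beta> \<gamma>)
  case Nil
  then show ?case
  proof (induction cs arbitrary: \<alpha> \<beta> \<gamma>)
    case Nil
    then show ?case by (simp add: dprod_Nil)
  next
    case (Cons c cs)
    have *: "\<beta> xs (c # Q @ c # ys) = 0" for xs Q ys
      using Cons.prems by (simp add: double_form_not_distinct)
    show ?case
      using Cons.IH[OF Cons.prems, of \<alpha> \<gamma>]
        Cons.IH[OF double_form_rins[OF Cons.prems, of c], of "rins c \<alpha>" \<gamma>]
        Cons.IH[OF double_form_rins[OF Cons.prems, of c], of "rsign \<alpha>" "rins c \<gamma>"]
      by (simp add: sublist_sum_add dprod_Cons_right distrib_left * mult_ac
          double_form_Cons_append(2)[OF Cons.prems] rins_def rsign_def)
  qed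
next
  case (Cons b bs)
  have *: "\<beta> (b # P @ b # xs) ys = 0" for xs P ys
    using Cons.prems by (simp add: double_form_not_distinct)
  show ?case
    using Cons.IH[OF Cons.prems, of \<alpha> \<gamma>]
      Cons.IH[OF double_form_lins[OF Cons.prems, of b], of "lins b \<alpha>" \<gamma>]
      Cons.IH[OF double_form_lins[OF Cons.prems, of b], of "lsign \<alpha>" "lins b \<gamma>"]
    by (simp add: sublist_sum_add dprod_Cons_left distrib_left * mult_ac
        double_form_Cons_append(1)[OF Cons.prems] lins_def lsign_def)
qed

lemma form_inner_interior:
  assumes "double_form \<beta>"
  shows "form_inner (interior \<alpha> \<beta>) \<gamma> = form_inner \<beta> (\<alpha> \<and>\<^sub>d \<gamma>)"
  unfolding form_inner_eq interior_def sum_interior_adjoint[OF assms, symmetric]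
  unfolding sublist_sum_distrib_right
  by (rule sublist_sum_cong) (rule sublist_sum_swap)

lemma iprod_eq_interior:
  assumes "double_form (\<beta> :: 'a::euclidean_space double_form)"
  shows "iprod \<alpha> \<beta> = interior \<alpha> \<beta>"
  unfolding iprod_def
proof (rule the_equality)
  show "double_form (interior \<alpha> \<beta>) \<and>
      (\<forall>\<gamma>. double_form \<gamma> \<longrightarrow> form_inner (interior \<alpha> \<beta>) \<gamma> = form_inner \<beta> (\<alpha> \<and>\<^sub>d \<gamma>))"
    using assms by (simp add: double_form_interior form_inner_interior)
next
  fix \<delta> assume \<delta>: "double_form \<delta> \<and>
      (\<forall>\<gamma>. double_form \<gamma> \<longrightarrow> form_inner \<delta> \<gamma> = form_inner \<beta> (\<alpha> \<and>\<^sub>d \<gamma>))"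
  \<comment> \<open>Two adjoints have the same inner product with every double form, in particular
    with their difference, which therefore has norm 0.\<close>
  let ?\<epsilon> = "\<lambda>xs ys. \<delta> xs ys - interior \<alpha> \<beta> xs ys"
  have \<epsilon>: "double_form ?\<epsilon>"
    using \<delta> assms by (simp add: double_form_diff double_form_interior)
  then have "form_inner \<delta> ?\<epsilon> = form_inner (interior \<alpha> \<beta>) ?\<epsilon>"
    using \<delta> assms by (simp add: form_inner_interior)
  then have "form_inner ?\<epsilon> ?\<epsilon> = 0"
    by (simp add: form_inner_def left_diff_distrib sum_subtractf)
  from form_inner_self_eq_0[OF \<epsilon> this] show "\<delta> = interior \<alpha> \<beta>"
    by (simp add: fun_eq_iff)
qed

section \<open>The metric form and the contraction\<close>

lemma sum_apply2: "(\<Sum>i\<in>X. \<omega> i) xs ys = (\<Sum>i\<in>X. \<omega> i xs ys)" for \<omega> :: "'i \<Rightarrow> 'a double_form"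
  by (induction X rule: infinite_finite_induct) simp_all

lemma metric_form_eq_0: "length P \<noteq> 1 \<or> length Q \<noteq> 1 \<Longrightarrow> metric_form P Q = 0"
  unfolding metric_form_def sum_apply2
  by (intro sum.neutral ballI) (auto simp: tensor_def covector_def split: list.splits)

lemma sum_list_frame: "(\<Sum>b\<leftarrow>frame. f b) = (\<Sum>b\<in>Basis. f b)"
  for f :: "'a::euclidean_space \<Rightarrow> real"
  using sum_list_distinct_conv_sum_set[OF frame(1)] frame(2) by metis

text \<open>The metric is supported on pairs of single vectors, and orthonormality leaves only equal
  basis vectors in both slots.\<close>

lemma contraction_eq:
  assumes "double_form (\<omega> :: 'a::euclidean_space double_form)"
  shows "contraction \<omega> = (\<lambda>xs ys. \<Sum>b\<in>Basis. \<omega> (b # xs) (b # ys))"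
proof (intro ext)
  fix xs ys
  have "contraction \<omega> xs ys = (\<Sum>b\<leftarrow>frame. \<Sum>c\<leftarrow>frame. (b \<bullet> c) * \<omega> (b # xs) (c # ys))"
    unfolding contraction_def iprod_eq_interior[OF assms] interior_def
    by (subst sublist_sum_singletons_only, simp add: metric_form_eq_0,
        subst sublist_sum_singletons_only)
      (simp_all add: metric_form_eq_0 metric_form_singletons)
  also have "\<dots> = (\<Sum>b\<in>Basis. \<omega> (b # xs) (b # ys))"
    unfolding sum_list_frame
    by (intro sum.cong refl) (simp add: inner_Basis if_distrib [where f="\<lambda>a. a * _"] cong: if_cong)
  finally show "contraction \<omega> xs ys = (\<Sum>b\<in>Basis. \<omega> (b # xs) (b # ys))" .
qed

lemma double_form_contraction: "double_form \<omega> \<Longrightarrow> double_form (contraction \<omega>)"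
  by (simp add: contraction_def iprod_eq_interior double_form_interior)

lemma double_form_contraction_power: "double_form \<omega> \<Longrightarrow> double_form ((contraction ^^ k) \<omega>)"
  by (induction k) (simp_all add: double_form_contraction)

subsection \<open>Contractions\<close>

text \<open>Over the frame this is the full contraction \<open>ncontr k \<omega> [] []\<close> of a
  double form; an arbitrary list makes induction possible.\<close>

definition trace :: "nat \<Rightarrow> 'a list \<Rightarrow> 'a double_form \<Rightarrow> real" where
  "trace k bs \<omega> = sublist_sum bs (\<lambda>K. of_bool (length K = k) * \<omega> K K)"

lemma trace_Cons:
  "trace (Suc k) (b # bs) \<omega> = trace k bs (lins b (rins b \<omega>)) + trace (Suc k) bs \<omega>"
  "trace 0 (b # bs) \<omega> = trace 0 bs \<omega>"
  by (simp_all add: trace_def)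

lemma trace_Nil: "trace 0 bs \<omega> = \<omega> [] []" "trace (Suc k) [] \<omega> = 0"
proof -
  show "trace 0 bs \<omega> = \<omega> [] []" by (induction bs) (simp_all add: trace_def)
  show "trace (Suc k) [] \<omega> = 0" by (simp add: trace_def)
qed

text \<open>Inserting in both slots at once produces every reordering sign twice, so such insertions
  commute, and inserting the same vector again gives 0.\<close>

lemma double_form_same_ins:
  assumes "double_form \<omega>"
  shows "lins b (rins b (lins b (rins b \<omega>))) = (\<lambda>xs ys. 0)"
    and "lins b (rins b (lins c (rins c \<omega>))) = lins c (rins c (lins b (rins b \<omega>)))"
proof -
  show "lins b (rins b (lins b (rins b \<omega>))) = (\<lambda>xs ys. 0)"
    using assms by (simp add: fun_eq_iff double_form_not_distinct)
  have "\<omega> (c # b # xs) (c # b # ys) = \<omega> (b # c # xs) (b # c # ys)" for xs ys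
    using double_form_Cons_append(1)[OF assms, of "[c]" b xs]
      double_form_Cons_append(2)[OF assms, of _ "[c]" b ys] by simp
  then show "lins b (rins b (lins c (rins c \<omega>))) = lins c (rins c (lins b (rins b \<omega>)))"
    by (simp add: fun_eq_iff)
qed

text \<open>Double counting: each sublist of length \<open>Suc k\<close> arises once for every entry
  \<open>c\<close> singled out of it, with the same diagonal value; if \<open>c\<close> is already
  in the sublist, the value is 0.\<close>

lemma sum_list_trace:
  assumes "double_form \<omega>"
  shows "(\<Sum>c\<leftarrow>bs. trace k bs (lins c (rins c \<omega>))) = real (Suc k) * trace (Suc k) bs \<omega>"
  using assms
proof (induction bs arbitrary: \<omega> k)
  case Nil
  then show ?case by (simp add: trace_Nil)
next
  case (Cons b bs)
  have IH: "(\<Sum>c\<leftarrow>bs. trace j bs (lins c (rins c \<omega>))) = real (Suc j) * trace (Suc j) bs \<omega>" for j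
    by (rule Cons.IH[OF Cons.prems])
  have IH': "(\<Sum>c\<leftarrow>bs. trace j bs (lins b (rins b (lins c (rins c \<omega>))))) =
      real (Suc j) * trace (Suc j) bs (lins b (rins b \<omega>))" for j
    unfolding double_form_same_ins(2)[OF Cons.prems, of b]
    by (rule Cons.IH[OF double_form_lins[OF double_form_rins[OF Cons.prems]]])
  have zero: "trace j bs (lins b (rins b (lins b (rins b \<omega>)))) = 0" for j
    unfolding double_form_same_ins(1)[OF Cons.prems] by (simp add: trace_def)
  show ?case
  proof (cases k)
    case 0
    then show ?thesis using IH[of 0] by (simp add: trace_Cons trace_Nil)
  next
    case (Suc j)
    show ?thesis
      unfolding Suc list.map sum_list.Cons trace_Cons sum_list_addf zero IH IH'
      by (simp add: algebra_simps)
  qed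
qed

text \<open>Each contraction picks one more basis vector, and a sublist is reached in all its
  orders, whence the factorial that \<open>ncontr\<close> divides out.\<close>

lemma contraction_power_eq:
  assumes "double_form (\<omega> :: 'a::euclidean_space double_form)"
  shows "(contraction ^^ k) \<omega> xs ys = fact k * trace k frame (\<lambda>K L. \<omega> (K @ xs) (L @ ys))"
  using assms
proof (induction k arbitrary: \<omega>)
  case 0
  then show ?case by (simp add: trace_Nil)
next
  case (Suc k)
  let ?\<eta> = "\<lambda>K L. \<omega> (K @ xs) (L @ ys)"
  have "trace k frame (\<lambda>K L. \<Sum>b\<in>Basis. \<omega> (b # K @ xs) (b # L @ ys)) =
      (\<Sum>b\<in>Basis. trace k frame (lins b (rins b ?\<eta>)))"
    unfolding trace_def ins_sign_apply append_Cons sum_distrib_left by (rule sublist_sum_sum)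
  also have "\<dots> = (\<Sum>b\<leftarrow>frame. trace k frame (lins b (rins b ?\<eta>)))"
    by (simp add: sum_list_frame)
  also have "\<dots> = real (Suc k) * trace (Suc k) frame ?\<eta>"
    by (rule sum_list_trace[OF double_form_suffix[OF Suc.prems]])
  \<comment> \<open>The contraction applied first is split off, so that the induction hypothesis is
    used for \<open>contraction \<omega>\<close>.\<close>
  finally show ?case
    using Suc.IH[OF double_form_contraction[OF Suc.prems]]
    by (simp add: funpow_Suc_right contraction_eq[OF Suc.prems] algebra_simps del: funpow.simps)
qed

lemma ncontr_eq:
  assumes "double_form (\<omega> :: 'a::euclidean_space double_form)"
  shows "ncontr k \<omega> xs ys = trace k frame (\<lambda>K L. \<omega> (K @ xs) (L @ ys))"
  by (simp add: ncontr_def dscale_def contraction_power_eq[OF assms])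

lemma double_form_ncontr: "double_form \<omega> \<Longrightarrow> double_form (ncontr k \<omega>)"
  unfolding ncontr_def dscale_def by (intro double_form_scale double_form_contraction_power)

subsection \<open>The trace of a product\<close>

text \<open>
  Inserting the first basis vector \<open>b\<close> into the four sublists \<open>C\<close>, \<open>P\<close>, \<open>Q\<close>, \<open>R\<close> gives a nonzero term only for
  \<open>C\<close>, \<open>P\<close>, \<open>Q\<close>, \<open>R\<close> alone, which are the four terms of the Leibniz rule in both slots, and for
  \<open>C\<close>, \<open>R\<close> together or \<open>P\<close>, \<open>Q\<close> together, which cancel each other.
\<close>

lemma trace_dprod:
  assumes "double_form \<alpha>" "double_form \<beta>"
  shows "sublist_sum bs (\<lambda>K. (\<alpha> \<and>\<^sub>d \<beta>) K K) =
    sublist_sum bs (\<lambda>C. sublist_sum bs (\<lambda>P. sublist_sum bs (\<lambda>Q. sublist_sum bs (\<lambda>R.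
      (-1) ^ (length P * length Q) * \<alpha> (C @ P) (C @ Q) * \<beta> (Q @ R) (P @ R)))))"
  using assms
proof (induction bs arbitrary: \<alpha> \<beta>)
  case Nil
  show ?case by (simp add: dprod_Nil)
next
  case (Cons b bs)
  note \<alpha> = Cons.prems(1) and \<beta> = Cons.prems(2)
  note ins = double_form_lins double_form_rins double_form_lsign double_form_rsign
  have zero: "\<alpha> (b # C @ b # P) ys = 0" "\<alpha> xs (b # C @ b # P) = 0"
    "\<beta> (b # C @ b # P) ys = 0" "\<beta> xs (b # C @ b # P) = 0"
    "\<alpha> (b # b # P) ys = 0" "\<alpha> xs (b # b # P) = 0"
    "\<beta> (b # b # P) ys = 0" "\<beta> xs (b # b # P) = 0" for C P xs ys
    using \<alpha> \<beta> by (simp_all add: double_form_not_distinct)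
  note IH = Cons.IH[OF \<alpha> \<beta>]
    Cons.IH[OF double_form_rins[OF double_form_lins[OF \<alpha>], of b b] \<beta>]
    Cons.IH[OF double_form_rsign[OF double_form_lins[OF \<alpha>], of b] double_form_rins[OF \<beta>, of b]]
    Cons.IH[OF double_form_rins[OF double_form_lsign[OF \<alpha>], of b] double_form_lins[OF \<beta>, of b]]
    Cons.IH[OF double_form_rsign[OF double_form_lsign[OF \<alpha>]] double_form_rins[OF double_form_lins[OF \<beta>, of b], of b]]
  have "sublist_sum (b # bs) (\<lambda>K. (\<alpha> \<and>\<^sub>d \<beta>) K K) =
      sublist_sum bs (\<lambda>K. (rins b (lins b \<alpha>) \<and>\<^sub>d \<beta>) K K) +
      sublist_sum bs (\<lambda>K. (rsign (lins b \<alpha>) \<and>\<^sub>d rins b \<beta>) K K) +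
      sublist_sum bs (\<lambda>K. (rins b (lsign \<alpha>) \<and>\<^sub>d lins b \<beta>) K K) +
      sublist_sum bs (\<lambda>K. (rsign (lsign \<alpha>) \<and>\<^sub>d rins b (lins b \<beta>)) K K) +
      sublist_sum bs (\<lambda>K. (\<alpha> \<and>\<^sub>d \<beta>) K K)"
    unfolding sublist_sum_Cons dprod_Cons_left
    unfolding dprod_Cons_right sublist_sum_add by simp
  also note IH(2) also note IH(3) also note IH(4) also note IH(5) also note IH(1)
  \<comment> \<open>Moving \<open>b\<close> to the front of each argument makes the signs agree. For
    \<open>P\<close> alone, the longer \<open>P\<close> gives (-1)^|Q| and the move past
    \<open>C\<close> gives (-1)^|C|, together the sign of \<open>rsign\<close> at
    \<open>C @ Q\<close>; the other cases are similar.\<close>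
  finally show ?case
    by (simp add: sublist_sum_add sublist_sum_minus sublist_sum_diff zero power_add mult_ac
      double_form_Cons_append[OF \<alpha>] double_form_Cons_append[OF \<beta>])
qed

subsection \<open>Homogeneous double forms\<close>

lemma dcomp_eq:
  "(\<omega> \<circ>\<^sub>d \<eta>) xs ys = sublist_sum frame (\<lambda>I. \<eta> xs I * \<omega> I ys)" for \<omega> :: "'a::euclidean_space double_form"
  by (simp add: dcomp_def endo_of_def sublist_sum_def basis_tuple_def length_frame)

lemma double_formsD: "\<omega> \<in> double_forms p q \<Longrightarrow> double_form \<omega>"
  by (simp add: double_forms_def)

lemma double_forms_length:
  "\<omega> \<in> double_forms p q \<Longrightarrow> \<omega> xs ys \<noteq> 0 \<Longrightarrow> length xs = p \<and> length ys = q"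
  by (simp add: double_forms_def)

lemma double_forms_add:
  assumes "\<omega> \<in> double_forms p q" "\<eta> \<in> double_forms p q"
  shows "\<omega> + \<eta> \<in> double_forms p q"
proof -
  have "length xs = p \<and> length ys = q" if "\<omega> xs ys + \<eta> xs ys \<noteq> 0" for xs ys
    using that double_forms_length[OF assms(1), of xs ys] double_forms_length[OF assms(2), of xs ys]
    by fastforce
  with assms show ?thesis
    by (simp add: double_forms_def double_form_def alternating_form_add func_plus)
qed

lemma double_forms_scale: "\<omega> \<in> double_forms p q \<Longrightarrow> c *\<^sub>d \<omega> \<in> double_forms p q"
  by (auto simp: double_forms_def dscale_def double_form_scale)

lemma double_forms_sum:
  assumes "\<And>i. i \<in> X \<Longrightarrow> \<omega> i \<in> double_forms p q"
  shows "(\<Sum>i\<in>X. \<omega> i) \<in> double_forms p q"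
proof -
  have "(\<Sum>i\<in>X. \<omega> i) = (\<lambda>xs ys. \<Sum>i\<in>X. \<omega> i xs ys)"
    by (intro ext) (rule sum_apply2)
  moreover have "length xs = p \<and> length ys = q" if nz: "(\<Sum>i\<in>X. \<omega> i xs ys) \<noteq> 0" for xs ys
  proof -
    from nz obtain i where "i \<in> X" "\<omega> i xs ys \<noteq> 0"
      by (rule sum.not_neutral_contains_not_neutral)
    then show ?thesis using double_forms_length[OF assms] by blast
  qed
  moreover have "double_form (\<lambda>xs ys. \<Sum>i\<in>X. \<omega> i xs ys)"
    by (rule double_form_sum) (rule double_formsD[OF assms])
  ultimately show ?thesis
    unfolding double_forms_def by simp
qed

lemma double_forms_11_eqI:
  assumes "\<omega> \<in> double_forms 1 1" "\<eta> \<in> double_forms 1 1" "\<And>a b. \<omega> [a] [b] = \<eta> [a] [b]"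
  shows "\<omega> = \<eta>"
proof (intro ext)
  fix xs ys
  show "\<omega> xs ys = \<eta> xs ys"
    using assms double_forms_length
    by (cases "length xs = 1 \<and> length ys = 1") (auto simp: length_Suc_conv double_forms_eq_0)
qed

lemma lins_double_forms: "\<omega> \<in> double_forms (Suc p) q \<Longrightarrow> lins v \<omega> \<in> double_forms p q"
  by (force simp: double_forms_def double_form_lins)

lemma rins_double_forms: "\<omega> \<in> double_forms p (Suc q) \<Longrightarrow> rins v \<omega> \<in> double_forms p q"
  by (force simp: double_forms_def double_form_rins)

lemma ncontr_sublist_sum:
  assumes "double_form (\<omega> :: 'a::euclidean_space double_form)"
  shows "ncontr k \<omega> xs ys =
    sublist_sum frame (\<lambda>K. of_bool (length K = k) * \<omega> (K @ xs) (K @ ys))"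
  by (simp add: ncontr_eq[OF assms] trace_def)

lemma ncontr_double_forms:
  assumes "\<omega> \<in> double_forms (k + p) (k + q)"
  shows "ncontr k \<omega> \<in> double_forms p q"
proof -
  have "length xs = p \<and> length ys = q" if "ncontr k \<omega> xs ys \<noteq> 0" for xs ys
  proof -
    from that obtain K where "of_bool (length K = k) * \<omega> (K @ xs) (K @ ys) \<noteq> 0"
      unfolding ncontr_sublist_sum[OF double_formsD[OF assms]] by (rule sublist_sum_neq_0E)
    then show ?thesis using double_forms_length[OF assms, of "K @ xs" "K @ ys"] by simp
  qed
  then show ?thesis
    using double_form_ncontr[OF double_formsD[OF assms]] by (simp add: double_forms_def)
qed

lemma interior_double_forms:
  assumes "\<alpha> \<in> double_forms p q" "\<beta> \<in> double_forms (p + p') (q + q')"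
  shows "interior \<alpha> \<beta> \<in> double_forms p' q'"
proof -
  have "length xs = p' \<and> length ys = q'" if "interior \<alpha> \<beta> xs ys \<noteq> 0" for xs ys
  proof -
    from that obtain P where "sublist_sum frame (\<lambda>Q. \<alpha> P Q * \<beta> (P @ xs) (Q @ ys)) \<noteq> 0"
      unfolding interior_def by (rule sublist_sum_neq_0E)
    then obtain Q where "\<alpha> P Q * \<beta> (P @ xs) (Q @ ys) \<noteq> 0"
      by (rule sublist_sum_neq_0E)
    then show ?thesis
      using double_forms_length[OF assms(1), of P Q]
        double_forms_length[OF assms(2), of "P @ xs" "Q @ ys"] by simp
  qed
  then show ?thesis
    using double_form_interior[OF double_formsD[OF assms(2)]] by (simp add: double_forms_def)
qed

lemma dcomp_double_forms:
  assumes "\<omega> \<in> double_forms q r" "\<eta> \<in> double_forms p q"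
  shows "\<omega> \<circ>\<^sub>d \<eta> \<in> double_forms p r"
proof -
  have "length xs = p \<and> length ys = r" if nz: "(\<omega> \<circ>\<^sub>d \<eta>) xs ys \<noteq> 0" for xs ys
  proof -
    from nz obtain I where "\<eta> xs I * \<omega> I ys \<noteq> 0"
      unfolding dcomp_eq by (rule sublist_sum_neq_0E)
    then show ?thesis
      using double_forms_length[OF assms(1), of I ys] double_forms_length[OF assms(2), of xs I] by simp
  qed
  moreover have "alternating_form (\<lambda>xs. \<eta> xs I * c)" for I c
    using alternating_form_scale[OF double_form_alternating(2)[OF double_formsD[OF assms(2)]], of c I]
    by (simp add: mult.commute)
  then have "double_form (\<omega> \<circ>\<^sub>d \<eta>)"
    unfolding double_form_def dcomp_eq[abs_def] sublist_sum_def
    using double_form_alternating[OF double_formsD[OF assms(1)]]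
    by (intro conjI allI alternating_form_sum alternating_form_scale)
  ultimately show ?thesis
    by (simp add: double_forms_def)
qed

lemma double_form_rotate:
  assumes "double_form \<omega>"
  shows "\<omega> (us @ vs @ ws) ys = (-1) ^ (length us * length vs) * \<omega> (vs @ us @ ws) ys"
    and "\<omega> xs (us @ vs @ ws) = (-1) ^ (length us * length vs) * \<omega> xs (vs @ us @ ws)"
  by (rule alternating_form_rotate[OF double_form_alternating(2)[OF assms]],
      rule alternating_form_rotate[OF double_form_alternating(1)[OF assms]])

subsection \<open>Traces of products of a form with itself\<close>

text \<open>In \<open>trace_dprod\<close>, exchanging \<open>C\<close> with \<open>R\<close> and
  \<open>P\<close> with \<open>Q\<close> exchanges the factors. The rotations cost the exponent (|P|
  + |Q|)(|C| + |R|), which by the degrees has the parity of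
  \<open>(p + q) * (p' + q)\<close>.\<close>

lemma trace_dprod_commute:
  assumes \<alpha>: "\<alpha> \<in> double_forms p q" and \<beta>: "\<beta> \<in> double_forms p' q'" and "even ((p + q) * (p' + q))"
  shows "sublist_sum bs (\<lambda>K. (\<alpha> \<and>\<^sub>d \<beta>) K K) = sublist_sum bs (\<lambda>K. (\<beta> \<and>\<^sub>d \<alpha>) K K)"
proof -
  have eq: "(-1) ^ (length P * length Q) * \<alpha> (C @ P) (C @ Q) * \<beta> (Q @ R) (P @ R) =
      (-1) ^ (length Q * length P) * \<beta> (R @ Q) (R @ P) * \<alpha> (P @ C) (Q @ C)" for C P Q R :: "'a list"
  proof (cases "length C + length P = p \<and> length C + length Q = q \<and> length Q + length R = p'")
    case True
    then have "even ((length P + length Q) * (length R + length C))"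
      using assms(3) by auto
    then have "(-1 :: real) ^ ((length P + length Q) * (length R + length C)) = 1"
      by simp
    moreover have "\<beta> (Q @ R) (P @ R) =
        (-1) ^ (length Q * length R + length P * length R) * \<beta> (R @ Q) (R @ P)"
      using double_form_rotate(1)[OF double_formsD[OF \<beta>], of Q R "[]"]
        double_form_rotate(2)[OF double_formsD[OF \<beta>], of _ P R "[]"] by (simp add: power_add)
    moreover have "\<alpha> (C @ P) (C @ Q) =
        (-1) ^ (length C * length P + length C * length Q) * \<alpha> (P @ C) (Q @ C)"
      using double_form_rotate(1)[OF double_formsD[OF \<alpha>], of C P "[]"]
        double_form_rotate(2)[OF double_formsD[OF \<alpha>], of _ C Q "[]"] by (simp add: power_add)
    ultimately show ?thesis
      by (simp add: power_add algebra_simps)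
  next
    case False
    then show ?thesis
      using double_forms_eq_0[OF \<alpha>, of "C @ P" "C @ Q"] double_forms_eq_0[OF \<alpha>, of "P @ C" "Q @ C"]
        double_forms_eq_0[OF \<beta>, of "Q @ R" "P @ R"] double_forms_eq_0[OF \<beta>, of "R @ Q" "R @ P"]
      by auto
  qed
  show ?thesis
    unfolding trace_dprod[OF double_formsD[OF \<alpha>] double_formsD[OF \<beta>]]
      trace_dprod[OF double_formsD[OF \<beta>] double_formsD[OF \<alpha>]] eq
    by (rule sublist_sum_reverse)
qed

lemma neg_one_power_cong: "even (j + k) \<Longrightarrow> (-1 :: real) ^ j = (-1) ^ k"
  by (cases "even j") auto

text \<open>In \<open>trace_dprod\<close> the sum over \<open>C\<close> of length \<open>r\<close>
  gives \<open>ncontr r \<omega>\<close>, the sums over \<open>P\<close> and \<open>Q\<close> form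
  the interior product, and \<open>R\<close>, of length \<open>r - 1\<close>, is the remaining
  contraction.\<close>

lemma trace_dprod_inserted:
  fixes \<omega> :: "'a::euclidean_space double_form"
  assumes \<omega>: "\<omega> \<in> double_forms p p" and sym: "symmetric_form \<omega>"
  shows "sublist_sum frame (\<lambda>K. (\<omega> \<and>\<^sub>d rins b (lins a \<omega>)) K K) =
    (\<Sum>r = 1..p. (-1) ^ (r + p) * ncontr (r - 1) (interior (ncontr r \<omega>) \<omega>) [a] [b])"
proof -
  let ?S = "sublist_sum (frame :: 'a list)"
  note df = double_formsD[OF \<omega>]
  define f where "f C P Q R = (-1) ^ (length P * length Q) * \<omega> (C @ P) (C @ Q) *
      \<omega> (a # Q @ R) (b # P @ R)" for C P Q R
  have len: "length C + length P = p \<and> length Q = length P \<and> length C = Suc (length R)"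
    if "f C P Q R \<noteq> 0" for C P Q R
    using that double_forms_length[OF \<omega>, of "C @ P" "C @ Q"]
      double_forms_length[OF \<omega>, of "a # Q @ R" "b # P @ R"] by (auto simp: f_def)
  \<comment> \<open>The insertions force |C| = |R| + 1, so \<open>r\<close> starts at 1 and
    \<open>r - 1\<close> is not truncated.\<close>
  have term_eq: "of_bool (length C = r) * f C P Q R =
      (-1) ^ (r + p) * (of_bool (length R = r - 1) * ((of_bool (length C = r) * \<omega> (C @ Q) (C @ P)) *
        \<omega> (Q @ R @ [a]) (P @ R @ [b])))" if "1 \<le> r" for r C P Q R
  proof (cases "length C + length P = p \<and> length Q = length P \<and> length C = Suc (length R)")
    case True
    have "\<omega> (a # Q @ R) (b # P @ R) =
        (-1) ^ (length Q + length R) * ((-1) ^ (length P + length R) * \<omega> (Q @ R @ [a]) (P @ R @ [b]))"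
      using double_form_rotate(1)[OF df, of "[a]" "Q @ R" "[]"]
        double_form_rotate(2)[OF df, of _ "[b]" "P @ R" "[]"] by simp
    \<comment> \<open>As |P| = |Q|, the exponent is a square with the parity of |P| = p -
      |C|.\<close>
    moreover have "(-1 :: real) ^ (length P * length P) = (-1) ^ (length C + p)"
      using True by (intro neg_one_power_cong) auto
    \<comment> \<open>The second factor carries \<open>Q\<close> and \<open>P\<close> in crossed
      slots; symmetry crosses the first one too, as \<open>interior\<close> demands.\<close>
    moreover have "\<omega> (C @ P) (C @ Q) = \<omega> (C @ Q) (C @ P)"
      using sym by (simp add: symmetric_form_def)
    ultimately show ?thesis
      using True that by (cases r) (auto simp: f_def)
  next
    case False
    then have "f C P Q R = 0" using len by blast
    moreover have "\<not> (length R = r - 1 \<and> length C = r \<and> \<omega> (C @ Q) (C @ P) \<noteq> 0)"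
      using False that double_forms_length[OF \<omega>, of "C @ Q" "C @ P"] by fastforce
    ultimately show ?thesis by auto
  qed
  have "?S (\<lambda>K. (\<omega> \<and>\<^sub>d rins b (lins a \<omega>)) K K) = ?S (\<lambda>C. ?S (\<lambda>P. ?S (\<lambda>Q. ?S (f C P Q))))"
    unfolding trace_dprod[OF df double_form_rins[OF double_form_lins[OF df]]] f_def by simp
  also have "\<dots> = (\<Sum>r = 1..p. ?S (\<lambda>C. of_bool (length C = r) * ?S (\<lambda>P. ?S (\<lambda>Q. ?S (f C P Q)))))"
  proof (rule sublist_sum_split_length)
    fix C assume "?S (\<lambda>P. ?S (\<lambda>Q. ?S (f C P Q))) \<noteq> 0"
    then obtain P Q R where "f C P Q R \<noteq> 0"
      by (metis sublist_sum_neq_0E)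
    with len[of C P Q R] show "length C \<in> {1..p}" by simp
  qed simp
  also have "\<dots> = (\<Sum>r = 1..p. (-1) ^ (r + p) * ncontr (r - 1) (interior (ncontr r \<omega>) \<omega>) [a] [b])"
  proof (intro sum.cong refl)
    fix r assume "r \<in> {1..p}"
    then have r: "1 \<le> r" by simp
    have "?S (\<lambda>C. of_bool (length C = r) * ?S (\<lambda>P. ?S (\<lambda>Q. ?S (f C P Q)))) =
        ?S (\<lambda>C. ?S (\<lambda>P. ?S (\<lambda>Q. ?S (\<lambda>R. of_bool (length C = r) * f C P Q R))))"
      by (simp only: sublist_sum_distrib_left)
    \<comment> \<open>The nesting order of the unfolded right-hand side:
      \<open>ncontr (r - 1)\<close> outside, then the two sums of \<open>interior\<close>, then
      \<open>ncontr r\<close>.\<close>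
    also have "\<dots> = ?S (\<lambda>R. ?S (\<lambda>Q. ?S (\<lambda>P. ?S (\<lambda>C. of_bool (length C = r) * f C P Q R))))"
      by (rule sublist_sum_reverse)
    also have "\<dots> = (-1) ^ (r + p) * ncontr (r - 1) (interior (ncontr r \<omega>) \<omega>) [a] [b]"
      unfolding term_eq[OF r] ncontr_sublist_sum[OF double_form_interior[OF df]]
      unfolding interior_def ncontr_sublist_sum[OF df] sublist_sum_distrib_left sublist_sum_distrib_right ..
    finally show "?S (\<lambda>C. of_bool (length C = r) * ?S (\<lambda>P. ?S (\<lambda>Q. ?S (f C P Q)))) =
        (-1) ^ (r + p) * ncontr (r - 1) (interior (ncontr r \<omega>) \<omega>) [a] [b]" .
  qed
  finally show ?thesis .
qed

text \<open>With \<open>a\<close> and \<open>b\<close> in different factors, the sums over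
  \<open>C\<close> and \<open>R\<close>, both of length \<open>r\<close>, give two copies of
  \<open>ncontr r \<omega>\<close>. The list \<open>P\<close> links a slot of one to a slot of the
  other, which is composition, and \<open>Q\<close>, of length \<open>p - r - 1\<close>, is
  contracted.\<close>

lemma trace_dprod_mixed:
  fixes \<omega> :: "'a::euclidean_space double_form"
  assumes \<omega>: "\<omega> \<in> double_forms p p" and "p \<ge> 1"
  shows "(-1) ^ p * sublist_sum frame (\<lambda>K. (rins b \<omega> \<and>\<^sub>d lins a \<omega>) K K) =
    (\<Sum>r = 0..p - 1. (-1) ^ (r + p) * ncontr (p - r - 1) (ncontr r \<omega> \<circ>\<^sub>d ncontr r \<omega>) [a] [b])"
proof -
  let ?S = "sublist_sum (frame :: 'a list)"
  note df = double_formsD[OF \<omega>]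
  define f where "f C P Q R = (-1) ^ (length P * length Q) * \<omega> (C @ P) (b # C @ Q) *
      \<omega> (a # Q @ R) (P @ R)" for C P Q R
  have len: "length C + length P = p \<and> length P = Suc (length Q) \<and> length C = length R"
    if "f C P Q R \<noteq> 0" for C P Q R
    using that double_forms_length[OF \<omega>, of "C @ P" "b # C @ Q"]
      double_forms_length[OF \<omega>, of "a # Q @ R" "P @ R"] by (auto simp: f_def)
  have term_eq: "of_bool (length C = r) * f C P Q R =
      (-1) ^ r * (of_bool (length Q = p - r - 1) *
        ((of_bool (length R = r) * \<omega> (R @ Q @ [a]) (R @ P)) *
         (of_bool (length C = r) * \<omega> (C @ P) (C @ Q @ [b]))))" if "r \<le> p - 1" for r C P Q R
  proof (cases "length C + length P = p \<and> length P = Suc (length Q) \<and> length C = length R")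
    case True
    have "\<omega> (C @ P) (b # C @ Q) = (-1) ^ (length C + length Q) * \<omega> (C @ P) (C @ Q @ [b])"
      using double_form_rotate(2)[OF df, of _ "[b]" "C @ Q" "[]"] by simp
    moreover have "\<omega> (a # Q @ R) (P @ R) =
        (-1) ^ (length Q + length R) * ((-1) ^ (length Q * length R) * ((-1) ^ (length P * length R) *
          \<omega> (R @ Q @ [a]) (R @ P)))"
      using double_form_rotate(1)[OF df, of "[a]" "Q @ R" "[]"]
        double_form_rotate(1)[OF df, of Q R "[a]"] double_form_rotate(2)[OF df, of _ P R "[]"]
      by simp
    \<comment> \<open>Here |P| = |Q| + 1 and |R| = |C|: the product |P||Q| is even, the middle terms
      are even in sum, and |R|(|P| + |Q|) is an odd multiple of |C|.\<close>
    moreover have "(-1 :: real) ^ (length P * length Q + (length C + length Q) + (length Q + length R) +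
        length Q * length R + length P * length R) = (-1) ^ length C"
      using True by (intro neg_one_power_cong) auto
    ultimately show ?thesis
      using True by (auto simp: f_def power_add mult_ac)
  next
    case False
    then have "f C P Q R = 0" using len by blast
    moreover have "\<not> (length R = r \<and> length C = r \<and> \<omega> (R @ Q @ [a]) (R @ P) \<noteq> 0)"
      using False double_forms_length[OF \<omega>, of "R @ Q @ [a]" "R @ P"] by fastforce
    ultimately show ?thesis by auto
  qed
  have "?S (\<lambda>K. (rins b \<omega> \<and>\<^sub>d lins a \<omega>) K K) = ?S (\<lambda>C. ?S (\<lambda>P. ?S (\<lambda>Q. ?S (f C P Q))))"
    unfolding trace_dprod[OF double_form_rins[OF df] double_form_lins[OF df]] f_def by simp
  also have "\<dots> = (\<Sum>r = 0..p - 1. ?S (\<lambda>C. of_bool (length C = r) * ?S (\<lambda>P. ?S (\<lambda>Q. ?S (f C P Q)))))"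
  proof (rule sublist_sum_split_length)
    fix C assume "?S (\<lambda>P. ?S (\<lambda>Q. ?S (f C P Q))) \<noteq> 0"
    then obtain P Q R where "f C P Q R \<noteq> 0"
      by (metis sublist_sum_neq_0E)
    with len[of C P Q R] show "length C \<in> {0..p - 1}" by auto
  qed simp
  also have "\<dots> = (\<Sum>r = 0..p - 1. (-1) ^ r * ncontr (p - r - 1) (ncontr r \<omega> \<circ>\<^sub>d ncontr r \<omega>) [a] [b])"
  proof (intro sum.cong refl)
    fix r assume "r \<in> {0..p - 1}"
    then have r: "r \<le> p - 1" "\<omega> \<in> double_forms (r + (p - r)) (r + (p - r))" using \<omega> by auto
    have "?S (\<lambda>C. of_bool (length C = r) * ?S (\<lambda>P. ?S (\<lambda>Q. ?S (f C P Q)))) =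
        ?S (\<lambda>C. ?S (\<lambda>P. ?S (\<lambda>Q. ?S (\<lambda>R. of_bool (length C = r) * f C P Q R))))"
      by (simp only: sublist_sum_distrib_left)
    also have "\<dots> = ?S (\<lambda>P. ?S (\<lambda>Q. ?S (\<lambda>R. ?S (\<lambda>C. of_bool (length C = r) * f C P Q R))))"
      by (rule sublist_sum_move_inwards)
    also have "\<dots> = ?S (\<lambda>Q. ?S (\<lambda>P. ?S (\<lambda>R. ?S (\<lambda>C. of_bool (length C = r) * f C P Q R))))"
      by (rule sublist_sum_swap)
    also have "\<dots> = ?S (\<lambda>Q. ?S (\<lambda>P. ?S (\<lambda>C. ?S (\<lambda>R. of_bool (length C = r) * f C P Q R))))"
      by (intro sublist_sum_cong_all sublist_sum_swap)
    also have "\<dots> = (-1) ^ r * ncontr (p - r - 1) (ncontr r \<omega> \<circ>\<^sub>d ncontr r \<omega>) [a] [b]"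
      unfolding term_eq[OF r(1)] dcomp_eq ncontr_sublist_sum[OF df]
        ncontr_sublist_sum[OF double_formsD[OF dcomp_double_forms[OF ncontr_double_forms[OF r(2)] ncontr_double_forms[OF r(2)]]]]
        sublist_sum_distrib_left sublist_sum_distrib_right append_assoc ..
    finally show "?S (\<lambda>C. of_bool (length C = r) * ?S (\<lambda>P. ?S (\<lambda>Q. ?S (f C P Q)))) =
        (-1) ^ r * ncontr (p - r - 1) (ncontr r \<omega> \<circ>\<^sub>d ncontr r \<omega>) [a] [b]" .
  qed
  finally show ?thesis
    by (simp add: sum_distrib_left power_add mult_ac)
qed

text \<open>Without insertions |C| = |R|, so the sums over \<open>C\<close> and \<open>R\<close>
  give the same form \<open>ncontr r \<omega>\<close> twice, and those over \<open>P\<close> and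
  \<open>Q\<close> its inner product with itself; symmetry uncrosses the slots of the second
  factor.\<close>

lemma trace_dprod_self:
  fixes \<omega> :: "'a::euclidean_space double_form"
  assumes \<omega>: "\<omega> \<in> double_forms p p" and sym: "symmetric_form \<omega>"
  shows "sublist_sum frame (\<lambda>K. (\<omega> \<and>\<^sub>d \<omega>) K K) =
    (\<Sum>r = 0..p. (-1) ^ (r + p) * (form_norm (ncontr r \<omega>))\<^sup>2)"
proof -
  let ?S = "sublist_sum (frame :: 'a list)"
  note df = double_formsD[OF \<omega>]
  define f where "f C P Q R = (-1) ^ (length P * length Q) * \<omega> (C @ P) (C @ Q) *
      \<omega> (Q @ R) (P @ R)" for C P Q R
  have len: "length C + length P = p \<and> length Q = length P \<and> length C = length R"
    if "f C P Q R \<noteq> 0" for C P Q R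
    using that double_forms_length[OF \<omega>, of "C @ P" "C @ Q"]
      double_forms_length[OF \<omega>, of "Q @ R" "P @ R"] by (auto simp: f_def)
  have term_eq: "of_bool (length C = r) * f C P Q R =
      (-1) ^ (r + p) * ((of_bool (length R = r) * \<omega> (R @ P) (R @ Q)) *
        (of_bool (length C = r) * \<omega> (C @ P) (C @ Q)))" for r C P Q R
  proof (cases "length C + length P = p \<and> length Q = length P \<and> length C = length R")
    case True
    have "\<omega> (Q @ R) (P @ R) = \<omega> (P @ R) (Q @ R)"
      using sym by (simp add: symmetric_form_def)
    also have "\<dots> = \<omega> (R @ P) (R @ Q)"
      using double_form_rotate(1)[OF df, of P R "[]"] double_form_rotate(2)[OF df, of _ Q R "[]"] True
      by simp
    moreover have "(-1 :: real) ^ (length P * length P) = (-1) ^ (length C + p)"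
      using True by (intro neg_one_power_cong) auto
    ultimately show ?thesis
      using True by (simp add: f_def)
  next
    case False
    then have "f C P Q R = 0" using len by blast
    moreover have "\<not> (length R = r \<and> length C = r \<and> \<omega> (C @ P) (C @ Q) \<noteq> 0)"
      using False double_forms_length[OF \<omega>, of "C @ P" "C @ Q"] by fastforce
    ultimately show ?thesis by auto
  qed
  have "?S (\<lambda>K. (\<omega> \<and>\<^sub>d \<omega>) K K) = ?S (\<lambda>C. ?S (\<lambda>P. ?S (\<lambda>Q. ?S (f C P Q))))"
    unfolding trace_dprod[OF df df] f_def by simp
  also have "\<dots> = (\<Sum>r = 0..p. ?S (\<lambda>C. of_bool (length C = r) * ?S (\<lambda>P. ?S (\<lambda>Q. ?S (f C P Q)))))"
  proof (rule sublist_sum_split_length)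
    fix C assume "?S (\<lambda>P. ?S (\<lambda>Q. ?S (f C P Q))) \<noteq> 0"
    then obtain P Q R where "f C P Q R \<noteq> 0"
      by (metis sublist_sum_neq_0E)
    with len[of C P Q R] show "length C \<in> {0..p}" by auto
  qed simp
  also have "\<dots> = (\<Sum>r = 0..p. (-1) ^ (r + p) * (form_norm (ncontr r \<omega>))\<^sup>2)"
  proof (intro sum.cong refl)
    fix r
    have "?S (\<lambda>C. of_bool (length C = r) * ?S (\<lambda>P. ?S (\<lambda>Q. ?S (f C P Q)))) =
        ?S (\<lambda>C. ?S (\<lambda>P. ?S (\<lambda>Q. ?S (\<lambda>R. of_bool (length C = r) * f C P Q R))))"
      by (simp only: sublist_sum_distrib_left)
    also have "\<dots> = ?S (\<lambda>P. ?S (\<lambda>Q. ?S (\<lambda>R. ?S (\<lambda>C. of_bool (length C = r) * f C P Q R))))"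
      by (rule sublist_sum_move_inwards)
    also have "\<dots> = ?S (\<lambda>P. ?S (\<lambda>Q. ?S (\<lambda>C. ?S (\<lambda>R. of_bool (length C = r) * f C P Q R))))"
      by (intro sublist_sum_cong_all sublist_sum_swap)
    also have "\<dots> = (-1) ^ (r + p) * (form_norm (ncontr r \<omega>))\<^sup>2"
      unfolding term_eq form_norm_power2 form_inner_eq ncontr_sublist_sum[OF df]
        sublist_sum_distrib_left sublist_sum_distrib_right ..
    finally show "?S (\<lambda>C. of_bool (length C = r) * ?S (\<lambda>P. ?S (\<lambda>Q. ?S (f C P Q)))) =
        (-1) ^ (r + p) * (form_norm (ncontr r \<omega>))\<^sup>2" .
  qed
  finally show ?thesis .
qed

text \<open>The Leibniz rule for \<open>a\<close> and \<open>b\<close> gives four traces. The two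
  with both vectors in one factor agree by \<open>trace_dprod_commute\<close>, as do the two mixed
  ones; this accounts for the factor 1/2.\<close>

lemma ncontr_dprod_self:
  fixes \<omega> :: "'a::euclidean_space double_form"
  assumes \<omega>: "\<omega> \<in> double_forms p p" and "p \<ge> 1"
  shows "1 / 2 * ncontr (2 * p - 1) (\<omega> \<and>\<^sub>d \<omega>) [a] [b] =
    sublist_sum frame (\<lambda>K. (\<omega> \<and>\<^sub>d rins b (lins a \<omega>)) K K) +
    (-1) ^ p * sublist_sum frame (\<lambda>K. (rins b \<omega> \<and>\<^sub>d lins a \<omega>) K K)"
proof -
  let ?S = "sublist_sum (frame :: 'a list)"
  note df = double_formsD[OF \<omega>]
  have sq: "\<omega> \<and>\<^sub>d \<omega> \<in> double_forms (2 * p) (2 * p)"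
    using dprod_double_forms[OF \<omega> \<omega>] by (simp add: mult_2)
  obtain m where p: "p = Suc m" using \<open>p \<ge> 1\<close> by (cases p) auto
  have \<omega>a: "lins a \<omega> \<in> double_forms m p" and \<omega>b: "rins b \<omega> \<in> double_forms p m"
    and \<omega>ab: "rins b (lins a \<omega>) \<in> double_forms m m"
    using \<omega> p by (auto intro!: lins_double_forms rins_double_forms)
  \<comment> \<open>The degree of the square already forces the length of \<open>K\<close>, and
    moving \<open>a\<close> and \<open>b\<close> past \<open>K\<close> costs the same sign in both
    slots.\<close>
  have "of_bool (length K = 2 * p - 1) * (\<omega> \<and>\<^sub>d \<omega>) (K @ [a]) (K @ [b]) =
      (\<omega> \<and>\<^sub>d \<omega>) (a # K) (b # K)" for K
    using double_forms_eq_0[OF sq, of "a # K" "b # K"] p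
      double_form_rotate(1)[OF double_formsD[OF sq], of "[a]" K "[]"]
      double_form_rotate(2)[OF double_formsD[OF sq], of _ "[b]" K "[]"]
    by auto
  then have "ncontr (2 * p - 1) (\<omega> \<and>\<^sub>d \<omega>) [a] [b] = ?S (\<lambda>K. (\<omega> \<and>\<^sub>d \<omega>) (a # K) (b # K))"
    by (simp add: ncontr_sublist_sum[OF double_formsD[OF sq]])
  also have "\<dots> = ?S (\<lambda>K. (rins b (lins a \<omega>) \<and>\<^sub>d \<omega>) K K) + ?S (\<lambda>K. (rsign (lins a \<omega>) \<and>\<^sub>d rins b \<omega>) K K) +
      (?S (\<lambda>K. (rins b (lsign \<omega>) \<and>\<^sub>d lins a \<omega>) K K) +
       ?S (\<lambda>K. (rsign (lsign \<omega>) \<and>\<^sub>d rins b (lins a \<omega>)) K K))"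
    unfolding dprod_Cons_left unfolding dprod_Cons_right sublist_sum_add ..
  \<comment> \<open>A form of fixed degree vanishes in all other degrees, so the degree signs become
    constants: 1 here, (-1)^p in the two mixed terms.\<close>
  also have "rsign (lsign \<omega>) = \<omega>"
  proof (intro ext)
    show "rsign (lsign \<omega>) xs ys = \<omega> xs ys" for xs ys
      using double_forms_eq_0[OF \<omega>, of xs ys]
      by (cases "length xs = p \<and> length ys = p") auto
  qed
  also have "rsign (lins a \<omega>) = (-1) ^ p *\<^sub>d lins a \<omega>"
  proof (intro ext)
    show "rsign (lins a \<omega>) xs ys = ((-1) ^ p *\<^sub>d lins a \<omega>) xs ys" for xs ys
      using double_forms_eq_0[OF \<omega>, of "a # xs" ys] by (cases "length ys = p") (auto simp: dscale_def)
  qed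
  also have "rins b (lsign \<omega>) = (-1) ^ p *\<^sub>d rins b \<omega>"
  proof (intro ext)
    show "rins b (lsign \<omega>) xs ys = ((-1) ^ p *\<^sub>d rins b \<omega>) xs ys" for xs ys
      using double_forms_eq_0[OF \<omega>, of xs "b # ys"] by (cases "length xs = p") (auto simp: dscale_def)
  qed
  also have "?S (\<lambda>K. (rins b (lins a \<omega>) \<and>\<^sub>d \<omega>) K K) = ?S (\<lambda>K. (\<omega> \<and>\<^sub>d rins b (lins a \<omega>)) K K)"
    by (rule trace_dprod_commute[OF \<omega>ab \<omega>]) simp
  also have "?S (\<lambda>K. ((-1) ^ p *\<^sub>d lins a \<omega> \<and>\<^sub>d rins b \<omega>) K K) =
      (-1) ^ p * ?S (\<lambda>K. (lins a \<omega> \<and>\<^sub>d rins b \<omega>) K K)"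
    by (simp add: dprod_def dscale_def sum_distrib_left sublist_sum_distrib_left mult_ac)
  also have "?S (\<lambda>K. (lins a \<omega> \<and>\<^sub>d rins b \<omega>) K K) = ?S (\<lambda>K. (rins b \<omega> \<and>\<^sub>d lins a \<omega>) K K)"
    by (rule trace_dprod_commute[OF \<omega>a \<omega>b]) simp
  also have "?S (\<lambda>K. ((-1) ^ p *\<^sub>d rins b \<omega> \<and>\<^sub>d lins a \<omega>) K K) =
      (-1) ^ p * ?S (\<lambda>K. (rins b \<omega> \<and>\<^sub>d lins a \<omega>) K K)"
    by (simp add: dprod_def dscale_def sum_distrib_left sublist_sum_distrib_left mult_ac)
  finally show ?thesis by (simp del: ins_sign_apply)
qed

subsection \<open>Forms of top degree\<close>

lemma double_form_bilinear:
  assumes "double_form \<omega>"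
  shows "bilinear (\<lambda>a b. \<omega> (a # us) (b # vs))"
  unfolding bilinear_def
  using alternating_form_linear[OF double_form_alternating(1)[OF assms], of _ "[]" vs]
    alternating_form_linear[OF double_form_alternating(2)[OF assms], of "[]" us] by simp

text \<open>Only the sublist omitting \<open>b\<close> has the right length and does not repeat
  \<open>b\<close>. Putting \<open>b\<close> back in its place costs the same sign in both
  slots.\<close>

lemma sublist_sum_codegree_1:
  assumes "double_form \<phi>" "distinct bs" "b \<in> set bs"
  shows "sublist_sum bs (\<lambda>K. of_bool (Suc (length K) = length bs) * \<phi> (b # K) (b # K)) = \<phi> bs bs"
  using assms
proof (induction bs arbitrary: \<phi>)
  case (Cons c bs)
  have zero: "sublist_sum bs (\<lambda>K. of_bool (Suc (length K) = length bs) * \<phi> (c # c # K) (c # c # K)) = 0"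
    using Cons.prems(1) by (simp add: double_form_not_distinct)
  have full: "sublist_sum bs (\<lambda>K. of_bool (length K = length bs) * \<phi> (b # K) (b # K)) = \<phi> (b # bs) (b # bs)"
    by (rule sublist_sum_full_length)
  show ?case
  proof (cases "b = c")
    case True
    then show ?thesis using zero full by simp
  next
    case False
    then have b: "b \<in> set bs" "distinct bs" using Cons.prems by auto
    have swap: "\<phi> (b # c # K) (b # c # K) = lins c (rins c \<phi>) (b # K) (b # K)" for K
      using double_form_Cons_append(1)[OF Cons.prems(1), of "[b]" c K]
        double_form_Cons_append(2)[OF Cons.prems(1), of _ "[b]" c K] by simp
    have "\<phi> (b # bs) (b # bs) = 0"
      using b Cons.prems(1) by (simp add: double_form_not_distinct)
    then show ?thesis
      using full Cons.IH[OF double_form_lins[OF double_form_rins[OF Cons.prems(1)]] b(2,1), of c c]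
      by (simp add: swap del: ins_sign_apply) simp
  qed
qed simp

text \<open>Both sides are bilinear in a pair of vectors, so basis vectors suffice. On the diagonal
  a single sublist contributes; off the diagonal there are too few basis vectors.\<close>

lemma ncontr_top_degree:
  fixes \<phi> :: "'a::euclidean_space double_form"
  assumes \<phi>: "\<phi> \<in> double_forms DIM('a) DIM('a)"
  shows "ncontr (DIM('a) - 1) \<phi> = \<phi> frame frame *\<^sub>d metric_form"
proof -
  let ?n = "DIM('a)"
  note df = double_formsD[OF \<phi>]
  have n: "?n \<ge> 1" by (simp add: DIM_positive Suc_leI)
  have \<phi>': "\<phi> \<in> double_forms (?n - 1 + 1) (?n - 1 + 1)" using \<phi> n by simp
  note nf = ncontr_double_forms[OF \<phi>']
  let ?B = "\<lambda>a b. ncontr (?n - 1) \<phi> [a] [b]"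
  have B: "?B a b = sublist_sum frame (\<lambda>K. of_bool (Suc (length K) = length (frame :: 'a list)) *
      \<phi> (a # K) (b # K))" for a b
  proof -
    have "\<phi> (K @ [a]) (K @ [b]) = \<phi> (a # K) (b # K)" for K
      using double_form_rotate(1)[OF df, of "[a]" K "[]"]
        double_form_rotate(2)[OF df, of _ "[b]" K "[]"] by simp
    moreover have "length K = ?n - 1 \<longleftrightarrow> Suc (length K) = ?n" for K :: "'a list"
      using n by auto
    ultimately show ?thesis
      by (simp add: ncontr_sublist_sum[OF df] length_frame)
  qed
  have "?B = (\<lambda>a b. \<phi> frame frame * (a \<bullet> b))"
  proof (rule bilinear_eq_stdbasis)
    show "bilinear ?B"
      using double_form_bilinear[OF double_formsD[OF nf], of "[]" "[]"] .
    show "bilinear (\<lambda>a b :: 'a. \<phi> frame frame * (a \<bullet> b))"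
      by (simp add: bilinear_def linear_iff inner_add algebra_simps)
  next
    fix i j :: 'a assume i: "i \<in> Basis" and j: "j \<in> Basis"
    show "?B i j = \<phi> frame frame * (i \<bullet> j)"
    proof (cases "i = j")
      case True
      have "i \<in> set (frame :: 'a list)" using i frame(2) by blast
      with True show ?thesis
        using sublist_sum_codegree_1[OF df frame(1), of i] i
        unfolding B by (simp add: inner_Basis)
    next
      case False
      have "?B i j = sublist_sum frame (\<lambda>K :: 'a list. 0)"
        unfolding B
      proof (rule sublist_sum_cong)
        fix K :: "'a list" assume K: "set K \<subseteq> set (frame :: 'a list)"
        show "of_bool (Suc (length K) = length (frame :: 'a list)) * \<phi> (i # K) (j # K) = 0"
        proof (rule ccontr)
          assume "\<not> ?thesis"
          then have len: "Suc (length K) = ?n" and "distinct (i # K)" "distinct (j # K)"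
            using double_form_not_distinct[OF df, of "i # K" "j # K"] by (auto simp: length_frame)
          \<comment> \<open>A nonzero term would make \<open>i\<close>, \<open>j\<close> and the
            entries of \<open>K\<close> one more distinct basis vectors than the dimension.\<close>
          then have "card (insert i (insert j (set K))) = Suc ?n"
            using False by (simp add: distinct_card)
          moreover have "card (insert i (insert j (set K))) \<le> ?n"
            using K i j frame(2) by (intro card_mono) auto
          ultimately show False by simp
        qed
      qed
      then show ?thesis
        using False i j by (simp add: inner_Basis)
    qed
  qed
  then have "?B a b = \<phi> frame frame * (a \<bullet> b)" for a b
    by meson
  then have "ncontr (?n - 1) \<phi> xs ys = (\<phi> frame frame *\<^sub>d metric_form) xs ys" for xs ys
    using double_forms_eq_0[OF nf, of xs ys] metric_form_eq_0[of xs ys]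
    by (cases "length xs = 1 \<and> length ys = 1")
      (auto simp: length_Suc_conv dscale_def metric_form_singletons)
  then show ?thesis by (intro ext)
qed

lemma trace_top_degree:
  fixes \<phi> :: "'a::euclidean_space double_form"
  assumes \<phi>: "\<phi> \<in> double_forms DIM('a) DIM('a)"
  shows "sublist_sum frame (\<lambda>K. \<phi> K K) = \<phi> frame frame"
proof -
  have "\<phi> K K = of_bool (length K = length (frame :: 'a list)) * \<phi> K K" for K
    using double_forms_eq_0[OF \<phi>, of K K] by (cases "length K = DIM('a)") (simp_all add: length_frame)
  then have "sublist_sum frame (\<lambda>K. \<phi> K K) =
      sublist_sum frame (\<lambda>K. of_bool (length K = length (frame :: 'a list)) * \<phi> K K)"
    by (intro sublist_sum_cong_all)
  then show ?thesis by (simp only: sublist_sum_full_length)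
qed

section \<open>Scalar factors and the assembly of the two identities\<close>

lemma interior_scalar:
  fixes \<alpha> :: "'a::euclidean_space double_form"
  assumes "\<alpha> \<in> double_forms 0 0"
  shows "interior \<alpha> \<beta> = \<alpha> [] [] *\<^sub>d \<beta>"
proof (intro ext)
  fix xs ys
  have "interior \<alpha> \<beta> xs ys = sublist_sum frame (\<lambda>Q. \<alpha> [] Q * \<beta> xs (Q @ ys))"
    unfolding interior_def
    by (subst sublist_sum_Nil_only) (simp_all add: double_forms_eq_0[OF assms])
  also have "\<dots> = (\<alpha> [] [] *\<^sub>d \<beta>) xs ys"
    by (subst sublist_sum_Nil_only) (simp_all add: double_forms_eq_0[OF assms] dscale_def)
  finally show "interior \<alpha> \<beta> xs ys = (\<alpha> [] [] *\<^sub>d \<beta>) xs ys" .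
qed

lemma ncontr_scale:
  assumes "double_form (\<omega> :: 'a::euclidean_space double_form)"
  shows "ncontr k (c *\<^sub>d \<omega>) = c *\<^sub>d ncontr k \<omega>"
proof -
  have "double_form (c *\<^sub>d \<omega>)"
    using assms unfolding dscale_def by (rule double_form_scale)
  then show ?thesis
    using assms
    by (simp add: fun_eq_iff ncontr_sublist_sum dscale_def sublist_sum_distrib_left mult.left_commute)
qed

lemma dprod_scalar:
  assumes "\<alpha> \<in> double_forms 0 0"
  shows "(\<alpha> \<and>\<^sub>d \<beta>) [a] [b] = \<alpha> [] [] * \<beta> [a] [b]"
  by (simp add: dprod_Cons_left dprod_Cons_right dprod_Nil double_forms_eq_0[OF assms])

theorem theorem1p11:
  fixes \<omega> :: "'a::euclidean_space double_form" and p :: nat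
  assumes "\<omega> \<in> double_forms p p"
    and "symmetric_form \<omega>"
    and "DIM('a) \<ge> 2 * p"
    and "2 * p \<ge> 4"
  shows "(1 / 2) *\<^sub>d ncontr (2 * p - 1) (\<omega> \<and>\<^sub>d \<omega>) =
      (-1) ^ p *\<^sub>d ncontr (p - 1) (\<omega> \<circ>\<^sub>d \<omega>) + ncontr p \<omega> \<and>\<^sub>d ncontr (p - 1) \<omega>
      + (\<Sum>r = 1..p - 1. (-1) ^ (r + p) *\<^sub>d
          (ncontr (r - 1) (iprod (ncontr r \<omega>) \<omega>)
           + ncontr (p - r - 1) (ncontr r \<omega> \<circ>\<^sub>d ncontr r \<omega>)))
    \<and> (DIM('a) = 2 * p \<longrightarrow>
        (\<Sum>r = 0..p. (-1) ^ (r + p) / 2 * (form_norm (ncontr r \<omega>))\<^sup>2) *\<^sub>d metric_form =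
        (-1) ^ p *\<^sub>d ncontr (p - 1) (\<omega> \<circ>\<^sub>d \<omega>) + ncontr p \<omega> \<and>\<^sub>d ncontr (p - 1) \<omega>
        + (\<Sum>r = 1..p - 1. (-1) ^ (r + p) *\<^sub>d
            (ncontr (r - 1) (iprod (ncontr r \<omega>) \<omega>)
             + ncontr (p - r - 1) (ncontr r \<omega> \<circ>\<^sub>d ncontr r \<omega>))))"
proof -
  note \<omega> = assms(1) and sym = assms(2)
  note df = double_formsD[OF \<omega>]
  have p: "p \<ge> 1" using assms(4) by simp
  let ?L = "(1 / 2) *\<^sub>d ncontr (2 * p - 1) (\<omega> \<and>\<^sub>d \<omega>)"
  let ?I = "\<lambda>r. ncontr (r - 1) (iprod (ncontr r \<omega>) \<omega>)"
  let ?C = "\<lambda>r. ncontr (p - r - 1) (ncontr r \<omega> \<circ>\<^sub>d ncontr r \<omega>)"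
  let ?R = "(-1) ^ p *\<^sub>d ncontr (p - 1) (\<omega> \<circ>\<^sub>d \<omega>) + ncontr p \<omega> \<and>\<^sub>d ncontr (p - 1) \<omega>
      + (\<Sum>r = 1..p - 1. (-1) ^ (r + p) *\<^sub>d (?I r + ?C r))"
  have sq: "\<omega> \<and>\<^sub>d \<omega> \<in> double_forms (2 * p) (2 * p)"
    using dprod_double_forms[OF \<omega> \<omega>] by (simp add: mult_2)
  have nc: "ncontr r \<omega> \<in> double_forms (p - r) (p - r)" if "r \<le> p" for r
    using \<omega> that by (intro ncontr_double_forms) simp
  have I_eq: "?I r = ncontr (r - 1) (interior (ncontr r \<omega>) \<omega>)" for r
    by (simp add: iprod_eq_interior[OF df])
  have I: "?I r \<in> double_forms 1 1" if "1 \<le> r" "r \<le> p" for r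
  proof -
    have "interior (ncontr r \<omega>) \<omega> \<in> double_forms r r"
      using \<omega> that by (intro interior_double_forms[OF nc]) auto
    then show ?thesis
      unfolding I_eq using that by (intro ncontr_double_forms) simp
  qed
  have C: "?C r \<in> double_forms 1 1" if r: "r \<le> p - 1" for r
  proof -
    have "ncontr r \<omega> \<circ>\<^sub>d ncontr r \<omega> \<in> double_forms (p - r) (p - r)"
      by (rule dcomp_double_forms[OF nc nc]) (use r in auto)
    moreover obtain k where "p - r = Suc k"
      using r p by (cases "p - r") auto
    ultimately show ?thesis
      using ncontr_double_forms[of _ k 1 1] by simp
  qed
  have nc0: "ncontr 0 \<eta> = \<eta>" for \<eta> :: "'a double_form"
    by (simp add: ncontr_def dscale_def)
  have L: "?L \<in> double_forms 1 1"
    using sq p by (intro double_forms_scale ncontr_double_forms) simp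
  have scalar: "ncontr p \<omega> \<in> double_forms 0 0" and ncp: "ncontr (p - 1) \<omega> \<in> double_forms 1 1"
    using nc[of p] nc[of "p - 1"] p by simp_all
  have R: "?R \<in> double_forms 1 1"
  proof (intro double_forms_add double_forms_scale double_forms_sum)
    show "ncontr (p - 1) (\<omega> \<circ>\<^sub>d \<omega>) \<in> double_forms 1 1"
      using C[of 0] by (simp add: nc0)
    show "ncontr p \<omega> \<and>\<^sub>d ncontr (p - 1) \<omega> \<in> double_forms 1 1"
      using dprod_double_forms[OF scalar ncp] by simp
    show "?I r \<in> double_forms 1 1" "?C r \<in> double_forms 1 1" if "r \<in> {1..p - 1}" for r
      using that I[of r] C[of r] by auto
  qed
  have first: "?L = ?R"
  proof (rule double_forms_11_eqI[OF L R])
    fix a b :: 'a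
    let ?s = "\<lambda>r. (-1 :: real) ^ (r + p)"
    have "?L [a] [b] = (\<Sum>r = 1..p. ?s r * ?I r [a] [b]) + (\<Sum>r = 0..p - 1. ?s r * ?C r [a] [b])"
      unfolding I_eq trace_dprod_inserted[OF \<omega> sym, symmetric] trace_dprod_mixed[OF \<omega> p, symmetric]
      using ncontr_dprod_self[OF \<omega> p, of a b] by (simp only: dscale_def)
    also have "(\<Sum>r = 1..p. ?s r * ?I r [a] [b]) =
        (\<Sum>r = 1..p - 1. ?s r * ?I r [a] [b]) + ?s p * ?I p [a] [b]"
      using p by (cases p) simp_all
    \<comment> \<open>For r = p the full contraction is a scalar: its interior product is
      multiplication by that scalar, which yields the product term, and the sign is (-1)^(2p) =
      1.\<close>
    also have "?s p * ?I p [a] [b] = (ncontr p \<omega> \<and>\<^sub>d ncontr (p - 1) \<omega>) [a] [b]"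
      unfolding I_eq interior_scalar[OF scalar] ncontr_scale[OF df] dprod_scalar[OF scalar]
      by (simp add: dscale_def power_add)
    \<comment> \<open>The term r = 0 involves no inner contraction and is the separate term with the
      composition of \<open>\<omega>\<close> with itself.\<close>
    also have "(\<Sum>r = 0..p - 1. ?s r * ?C r [a] [b]) =
        (-1) ^ p * ncontr (p - 1) (\<omega> \<circ>\<^sub>d \<omega>) [a] [b] + (\<Sum>r = 1..p - 1. ?s r * ?C r [a] [b])"
      by (subst sum.atLeast_Suc_atMost) (simp_all add: nc0)
    finally show "?L [a] [b] = ?R [a] [b]"
      by (simp add: sum_apply2 dscale_def distrib_left sum.distrib)
  qed
  have second: "(\<Sum>r = 0..p. (-1) ^ (r + p) / 2 * (form_norm (ncontr r \<omega>))\<^sup>2) *\<^sub>d metric_form = ?L"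
    if n: "DIM('a) = 2 * p"
  proof -
    have top: "\<omega> \<and>\<^sub>d \<omega> \<in> double_forms DIM('a) DIM('a)"
      using sq n by simp
    \<comment> \<open>In top degree only the full frame contributes to the trace of the square, so
      \<open>trace_dprod_self\<close> evaluates its single coefficient.\<close>
    have "(\<Sum>r = 0..p. (-1) ^ (r + p) / 2 * (form_norm (ncontr r \<omega>))\<^sup>2) =
        (\<omega> \<and>\<^sub>d \<omega>) frame frame / 2"
      unfolding trace_top_degree[OF top, symmetric] trace_dprod_self[OF \<omega> sym]
      by (simp add: sum_divide_distrib)
    then show ?thesis
      using ncontr_top_degree[OF top] n by (simp add: fun_eq_iff dscale_def)
  qed
  show ?thesis
    by (intro conjI impI first trans[OF second first])
qed

end
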